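(* For every choice of over/under information at the crossings: (i) $A1E1$ is a trivial knot (a circle); (ii) $A2E2$ is a trivial knot.
   Context: Six blades numbered $1,\dots,6$ are drawn as parallel horizontal segments stacked in order in the plane. The six left ends are tied in pairs and the six right ends are tied in pairs. A tying pattern on one side is a partition of $\{1,\dots,6\}$ into three pairs; writing $ij$ for $\{i,j\}$, the patterns used here are $A1=\{12,34,56\}$, $A2=\{16,23,45\}$, and $E1$, $E2$, both with pairs $\{14,25,36\}$. On the right side each pair $ij$ is drawn as a simple arc lying to the right of the blades and joining the right ends of blades $i$ and $j$; two arcs $ij$ and $kl$ cross transversally exactly once if their endpoints interleave, and are disjoint otherwise. $E1$ and $E2$ are the two different drawings of $\{14,25,36\}$: in $E1$, arc $14$ traversed from $1$ meets $25$ then $36$, arc $25$ traversed from $2$ meets $14$ then $36$, and arc $36$ traversed from $3$ meets $14$ then $25$; in $E2$ all these orders are reversed (arc $14$ from $1$ meets $36$ then $25$, arc $25$ from $2$ meets $36$ then $14$, arc $36$ from $3$ meets $25$ then $14$). Left ends are drawn in the same way, mirrored to the left side. The tied six-blade $XY$ is the closed plane projection obtained with left end $X$ and right end $Y$; at each crossing either of the two strands may be the upper one, and each choice gives a knot diagram. *)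

theory Defs
  imports "HOL-Analysis.Analysis"
begin

text \<open>The plane is \<^typ>\<open>complex\<close>; space is \<^typ>\<open>complex \<times> real\<close>, with \<^const>\<open>fst\<close>
  the projection to the plane and \<^const>\<open>snd\<close> the height.\<close>

definition ambient_isotopic :: "'a::euclidean_space set \<Rightarrow> 'a set \<Rightarrow> bool" where
  "ambient_isotopic K L \<longleftrightarrow>
     (\<exists>H :: real \<times> 'a \<Rightarrow> 'a.
        continuous_on ({0..1} \<times> UNIV) H \<and>
        (\<forall>t\<in>{0..1}. \<exists>G. homeomorphism UNIV UNIV (\<lambda>x. H (t, x)) G) \<and>
        (\<forall>x. H (0, x) = x) \<and>
        (\<lambda>x. H (1, x)) ` K = L)"

definition trivial_knot :: "(complex \<times> real) set \<Rightarrow> bool" where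
  "trivial_knot K \<longleftrightarrow> ambient_isotopic K (sphere 0 1 \<times> {0})"


text \<open>The tie \<open>ij\<close> is encoded by the pair \<open>(i, j)\<close> with \<open>i < j\<close>.\<close>

type_synonym tie = "nat \<times> nat"

datatype tying = A1 | A2 | E1 | E2

primrec ties :: "tying \<Rightarrow> tie set" where
  "ties A1 = {(1,2), (3,4), (5,6)}"
| "ties A2 = {(1,6), (2,3), (4,5)}"
| "ties E1 = {(1,4), (2,5), (3,6)}"
| "ties E2 = {(1,4), (2,5), (3,6)}"

text \<open>A triple \<open>(e, f, f')\<close> says that the arc \<open>e\<close>, traversed from its smaller blade,
  meets \<open>f\<close> before \<open>f'\<close>.\<close>

primrec crossing_order :: "tying \<Rightarrow> (tie \<times> tie \<times> tie) set" where
  "crossing_order A1 = {}"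
| "crossing_order A2 = {}"
| "crossing_order E1 =
     {((1,4), (2,5), (3,6)), ((2,5), (1,4), (3,6)), ((3,6), (1,4), (2,5))}"
| "crossing_order E2 =
     {((1,4), (3,6), (2,5)), ((2,5), (3,6), (1,4)), ((3,6), (2,5), (1,4))}"

fun interleave :: "tie \<Rightarrow> tie \<Rightarrow> bool" where
  "interleave (i, j) (k, l) \<longleftrightarrow> i < k \<and> k < j \<and> j < l \<or> k < i \<and> i < l \<and> l < j"

text \<open>\<open>p i\<close> is the end of blade \<open>i\<close> on the side considered and \<open>S\<close> the open half-plane beyond
  the blades.  Arcs are merely continuous; for two arcs in a half-plane whose ends interleave,
  having exactly one common point already forces them to cross there, which is why
  transversality is not a separate clause.  Distinct parameters in the last clause also
  exclude triple points.\<close>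

definition end_drawing ::
    "tying \<Rightarrow> (nat \<Rightarrow> complex) \<Rightarrow> complex set \<Rightarrow> (tie \<Rightarrow> real \<Rightarrow> complex) \<Rightarrow> bool" where
  "end_drawing X p S g \<longleftrightarrow>
     (\<forall>(i, j)\<in>ties X.
        arc (g (i, j)) \<and> pathstart (g (i, j)) = p i \<and> pathfinish (g (i, j)) = p j \<and>
        g (i, j) ` {0<..<1} \<subseteq> S) \<and>
     (\<forall>e\<in>ties X. \<forall>f\<in>ties X. e \<noteq> f \<longrightarrow>
        (if interleave e f
         then \<exists>!z. z \<in> path_image (g e) \<inter> path_image (g f)
         else path_image (g e) \<inter> path_image (g f) = {})) \<and>
     (\<forall>(e, f, f')\<in>crossing_order X. \<forall>s\<in>{0..1}. \<forall>t\<in>{0..1}.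
        g e s \<in> path_image (g f) \<and> g e t \<in> path_image (g f') \<longrightarrow> s < t)"

datatype strand = Blade nat | LTie tie | RTie tie

definition strands :: "tying \<Rightarrow> tying \<Rightarrow> strand set" where
  "strands X Y = Blade ` {1..6} \<union> LTie ` ties X \<union> RTie ` ties Y"

text \<open>Blade 1 is the topmost one.\<close>

definition six_blade_projection ::
    "tying \<Rightarrow> tying \<Rightarrow> (strand \<Rightarrow> real \<Rightarrow> complex) \<Rightarrow> bool" where
  "six_blade_projection X Y D \<longleftrightarrow>
     (\<exists>(l::real) (r::real) (y :: nat \<Rightarrow> real).
        l < r \<and> strict_antimono_on {1..6} y \<and>
        (\<forall>i\<in>{1..6}. D (Blade i) = linepath (Complex l (y i)) (Complex r (y i))) \<and>
        end_drawing X (\<lambda>i. Complex l (y i)) {z. Re z < l} (D \<circ> LTie) \<and>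
        end_drawing Y (\<lambda>i. Complex r (y i)) {z. r < Re z} (D \<circ> RTie))"

definition crossings :: "tying \<Rightarrow> tying \<Rightarrow> strand set set" where
  "crossings X Y =
     {{LTie e, LTie f} | e f. e \<in> ties X \<and> f \<in> ties X \<and> interleave e f} \<union>
     {{RTie e, RTie f} | e f. e \<in> ties Y \<and> f \<in> ties Y \<and> interleave e f}"

text \<open>A choice \<open>u\<close> of over/under information assigns to each crossing its upper strand.\<close>

definition over_under_choice :: "tying \<Rightarrow> tying \<Rightarrow> (strand set \<Rightarrow> strand) \<Rightarrow> bool" where
  "over_under_choice X Y u \<longleftrightarrow> (\<forall>c\<in>crossings X Y. u c \<in> c)"

text \<open>\<open>K\<close> is a curve in space with diagram \<open>(D, u)\<close>: each strand \<open>s\<close> is lifted to the graph of a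
  height function \<open>h s\<close>.  Strands with a common point that is not a crossing share a blade end
  there, and their lifts are joined.\<close>

definition has_diagram ::
    "tying \<Rightarrow> tying \<Rightarrow> (strand \<Rightarrow> real \<Rightarrow> complex) \<Rightarrow> (strand set \<Rightarrow> strand) \<Rightarrow>
     (complex \<times> real) set \<Rightarrow> bool" where
  "has_diagram X Y D u K \<longleftrightarrow>
     (\<exists>h :: strand \<Rightarrow> complex \<Rightarrow> real.
        (\<forall>s\<in>strands X Y. continuous_on (path_image (D s)) (h s)) \<and>
        (\<forall>s\<in>strands X Y. \<forall>t\<in>strands X Y. \<forall>z \<in> path_image (D s) \<inter> path_image (D t).
           if {s, t} \<in> crossings X Y
           then (if u {s, t} = s then h t z < h s z else h s z < h t z)
           else h s z = h t z) \<and>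
        K = (\<Union>s\<in>strands X Y. (\<lambda>z. (z, h s z)) ` path_image (D s)))"

end

theory Submission
  imports Defs
begin

text \<open>Both diagrams have the cyclic Gauss code \<open>a b b c c a\<close> (all loops are nugatory), so for
  every choice of signs the curve can be made to run from one maximum of the height down to one
  minimum and up again.  No tameness theorem for the merely continuous arcs is needed, because two kinds
  of fibrewise affine homeomorphisms of space suffice.  Those of the form
  \<open>(z, h) \<mapsto> (z, exp (\<nu> z) * h + \<Phi> z)\<close>, with \<open>\<nu>\<close> and \<open>\<Phi>\<close>
  from Tietze's theorem, replace the heights by any others with the same order at the crossings.  Once the curve
  consists of two strands that are graphs over the height, a map
  \<open>(z, h) \<mapsto> ((z - c h) * exp (- L h), h)\<close> makes it a round circle.\<close>

section \<open>Ambient isotopies\<close>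

text \<open>Two points shape the proof. Maps of the second kind need the difference of the two
  strands, divided by \<open>sin (pi * t)\<close>, to be continuous and nonzero even at the two
  extrema, where difference and sine both vanish. A merely continuous arc gives no control there, so
  the extrema are placed at midpoints of blades, where the two strands leave along one line in
  opposite directions. Maps of the first kind move nothing in the plane and preserve the order of
  the heights at a crossing, so the prescribed heights must already have the right order. The
  freedom used for this is the parametrisation of an arc: it changes the heights at the crossings
  and leaves the projection as it is. The pairing of left and right ends matters: with
  \<open>E1\<close> and \<open>E2\<close> exchanged the code would be \<open>a b c a b c\<close>,
  that of the trefoil projection.\<close>

lemma ambient_isotopicI:
  fixes F G :: "real \<Rightarrow> 'a::euclidean_space \<Rightarrow> 'a"
  assumes F: "continuous_on ({0..1} \<times> UNIV) (\<lambda>p. F (fst p) (snd p))"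
    and G: "\<And>t. continuous_on UNIV (G t)"
    and GF: "\<And>t x. G t (F t x) = x" and FG: "\<And>t x. F t (G t x) = x"
    and F0: "\<And>x. F 0 x = x" and F1: "F 1 ` K = L"
  shows "ambient_isotopic K L"
proof -
  have "homeomorphism UNIV UNIV (F t) (G t)" if "t \<in> {0..1}" for t
  proof -
    have "continuous_on UNIV (\<lambda>x. (\<lambda>p. F (fst p) (snd p)) (t, x))"
      by (rule continuous_on_compose2[OF F]) (use that in \<open>auto intro!: continuous_intros\<close>)
    moreover have "range (F t) = UNIV" "range (G t) = UNIV"
      using GF FG by (metis surjI)+
    ultimately show ?thesis
      using G GF FG by (simp add: homeomorphism_def)
  qed
  then show ?thesis
    unfolding ambient_isotopic_def using F F0 F1
    by (intro exI[of _ "\<lambda>p. F (fst p) (snd p)"] conjI ballI allI) auto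
qed

lemma ambient_isotopic_trans:
  fixes K L M :: "'a::euclidean_space set"
  assumes "ambient_isotopic K L" "ambient_isotopic L M"
  shows "ambient_isotopic K M"
proof -
  obtain H :: "real \<times> 'a \<Rightarrow> 'a" where H: "continuous_on ({0..1} \<times> UNIV) H"
      "\<forall>t\<in>{0..1}. \<exists>G. homeomorphism UNIV UNIV (\<lambda>x. H (t, x)) G"
      "\<forall>x. H (0, x) = x" "(\<lambda>x. H (1, x)) ` K = L"
    using assms(1) unfolding ambient_isotopic_def by blast
  obtain H' :: "real \<times> 'a \<Rightarrow> 'a" where H': "continuous_on ({0..1} \<times> UNIV) H'"
      "\<forall>t\<in>{0..1}. \<exists>G. homeomorphism UNIV UNIV (\<lambda>x. H' (t, x)) G"
      "\<forall>x. H' (0, x) = x" "(\<lambda>x. H' (1, x)) ` L = M"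
    using assms(2) unfolding ambient_isotopic_def by blast
  let ?J = "\<lambda>p. H' (fst p, H p)"
  have "continuous_on ({0..1} \<times> UNIV) ?J"
    by (rule continuous_on_compose2[OF H'(1)]) (auto intro!: continuous_intros H(1))
  moreover have "\<exists>G. homeomorphism UNIV UNIV (\<lambda>x. ?J (t, x)) G" if t: "t \<in> {0..1}" for t
  proof -
    obtain G where "homeomorphism UNIV UNIV (\<lambda>x. H (t, x)) G" using H(2) t by blast
    moreover obtain G' where "homeomorphism UNIV UNIV (\<lambda>x. H' (t, x)) G'" using H'(2) t by blast
    ultimately show ?thesis
      using homeomorphism_compose[of UNIV UNIV "\<lambda>x. H (t, x)" G UNIV "\<lambda>x. H' (t, x)" G']
      by (auto simp: o_def)
  qed
  moreover have "(\<lambda>x. ?J (1, x)) ` K = M"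
    using H(4) H'(4) by (auto simp: image_iff)
  ultimately show ?thesis
    unfolding ambient_isotopic_def using H(3) H'(3) by (intro exI[of _ ?J]) auto
qed

section \<open>Changing the heights over a fixed projection\<close>

text \<open>By \<open>eq\<close> the function \<open>H' i z - exp (\<nu> z) * H i z\<close> is the
  same for all \<open>i\<close> with \<open>z\<close> in \<open>\<Gamma> i\<close>, so these
  functions paste together on a closed set. The factor \<open>exp (\<nu> z)\<close> is positive,
  which makes the map invertible on every vertical line.\<close>

lemma ambient_isotopic_graphs:
  fixes \<Gamma> :: "'i \<Rightarrow> complex set" and H H' :: "'i \<Rightarrow> complex \<Rightarrow> real" and \<nu> :: "complex \<Rightarrow> real"
  assumes I: "finite I" and clo: "\<And>i. i \<in> I \<Longrightarrow> closed (\<Gamma> i)"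
    and H: "\<And>i. i \<in> I \<Longrightarrow> continuous_on (\<Gamma> i) (H i)"
    and H': "\<And>i. i \<in> I \<Longrightarrow> continuous_on (\<Gamma> i) (H' i)"
    and \<nu>: "continuous_on UNIV \<nu>"
    and eq: "\<And>i j z. \<lbrakk>i \<in> I; j \<in> I; z \<in> \<Gamma> i; z \<in> \<Gamma> j\<rbrakk> \<Longrightarrow>
      H' i z - H' j z = exp (\<nu> z) * (H i z - H j z)"
  shows "ambient_isotopic (\<Union>i\<in>I. (\<lambda>z. (z, H i z)) ` \<Gamma> i) (\<Union>i\<in>I. (\<lambda>z. (z, H' i z)) ` \<Gamma> i)"
proof -
  let ?U = "\<Union>i\<in>I. \<Gamma> i"
  define f where "f = (\<lambda>i z. H' i z - exp (\<nu> z) * H i z)"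
  have fc: "continuous_on (\<Gamma> i) (f i)" if "i \<in> I" for i
    unfolding f_def using that
    by (intro continuous_intros H H' continuous_on_subset[OF \<nu>]) auto
  have feq: "f i z = f j z" if "i \<in> I" "j \<in> I" "z \<in> \<Gamma> i" "z \<in> \<Gamma> j" for i j z
    using eq[OF that] by (simp add: f_def algebra_simps)
  obtain g where g: "continuous_on ?U g" and gf: "\<And>z i. \<lbrakk>i \<in> I; z \<in> \<Gamma> i\<rbrakk> \<Longrightarrow> g z = f i z"
  proof (rule pasting_lemma_exists_closed[OF I, of "top_of_set ?U" \<Gamma> euclidean f])
    show "topspace (top_of_set ?U) \<subseteq> \<Union> (\<Gamma> ` I)" by simp
    show "closedin (top_of_set ?U) (\<Gamma> i)" if "i \<in> I" for i
      using clo[OF that] that by (intro closed_subset) auto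
    show "continuous_map (subtopology (top_of_set ?U) (\<Gamma> i)) euclidean (f i)" if "i \<in> I" for i
    proof -
      have "?U \<inter> \<Gamma> i = \<Gamma> i" using that by auto
      then show ?thesis using fc[OF that] by (simp add: subtopology_subtopology)
    qed
    show "f i x = f j x" if "i \<in> I" "j \<in> I" "x \<in> topspace (top_of_set ?U) \<inter> \<Gamma> i \<inter> \<Gamma> j" for i j x
      using that by (intro feq) auto
  qed auto
  have "closed ?U" using I clo by auto
  then obtain \<Phi> where \<Phi>: "continuous_on UNIV \<Phi>" and \<Phi>g: "\<And>z. z \<in> ?U \<Longrightarrow> \<Phi> z = g z"
    using Tietze_unbounded[OF g, of UNIV] by (metis closed_closedin subtopology_UNIV)
  define F where "F = (\<lambda>t (p::complex \<times> real). (fst p, exp (t * \<nu> (fst p)) * snd p + t * \<Phi> (fst p)))"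
  define G where "G = (\<lambda>t (p::complex \<times> real). (fst p, exp (- (t * \<nu> (fst p))) * (snd p - t * \<Phi> (fst p))))"
  show ?thesis
  proof (rule ambient_isotopicI[of F G])
    show "continuous_on ({0..1} \<times> UNIV) (\<lambda>p. F (fst p) (snd p))"
      unfolding F_def
      by (intro continuous_intros continuous_on_compose2[OF \<nu>] continuous_on_compose2[OF \<Phi>]) auto
    show "continuous_on UNIV (G t)" for t
      unfolding G_def
      by (intro continuous_intros continuous_on_compose2[OF \<nu>] continuous_on_compose2[OF \<Phi>]) auto
    have F1: "F 1 (z, H i z) = (z, H' i z)" if "i \<in> I" "z \<in> \<Gamma> i" for i z
    proof -
      have "\<Phi> z = f i z" using that \<Phi>g[of z] gf[of i z] by auto
      then show ?thesis by (simp add: F_def f_def)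
    qed
    show "F 1 ` (\<Union>i\<in>I. (\<lambda>z. (z, H i z)) ` \<Gamma> i) = (\<Union>i\<in>I. (\<lambda>z. (z, H' i z)) ` \<Gamma> i)"
      unfolding image_UN image_image by (intro SUP_cong image_cong refl F1)
    show "G t (F t p) = p" for t p
      by (simp add: F_def G_def mult.assoc[symmetric] flip: exp_add)
    show "F t (G t p) = p" for t p
      by (simp add: F_def G_def mult.assoc[symmetric] flip: exp_add)
  qed (simp add: F_def)
qed

lemma finite_real_interpolation:
  fixes X :: "complex set" and f :: "complex \<Rightarrow> real"
  assumes "finite X"
  obtains g where "continuous_on UNIV g" "\<And>x. x \<in> X \<Longrightarrow> g x = f x"
  using Tietze_unbounded[of X f UNIV] assms
  by (metis closed_closedin subtopology_UNIV continuous_on_finite finite_imp_closed)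

section \<open>Curves with one maximum and one minimum of the height\<close>

lemma trivial_knot_round_circle:
  "trivial_knot ((\<lambda>t. (complex_of_real (sin (pi * t)), cos (pi * t))) ` {0..1} \<union>
     (\<lambda>t. (- complex_of_real (sin (pi * t)), cos (pi * t))) ` {0..1})" (is "trivial_knot ?K")
proof -
  \<comment> \<open>Rotation about the real axis: the given circle stands upright over that axis,
    and a quarter turn lays it flat.\<close>
  define F where "F = (\<lambda>t (p::complex \<times> real).
    (complex_of_real (Re (fst p)) +
      \<i> * complex_of_real (Im (fst p) * cos (t * (pi/2)) - snd p * sin (t * (pi/2))),
     Im (fst p) * sin (t * (pi/2)) + snd p * cos (t * (pi/2))))"
  have inv: "F (- t) (F t p) = p" for t p
  proof -
    let ?c = "cos (t * (pi/2))" and ?s = "sin (t * (pi/2))"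
    have "y * (?c * ?c) + y * (?s * ?s) = y" for y :: real
      by (simp flip: distrib_left power2_eq_square)
    from this[of "Im (fst p)"] this[of "snd p"] show ?thesis
      by (simp add: F_def complex_eq_iff prod_eq_iff algebra_simps)
  qed
  have F1: "F 1 ` ?K = sphere 0 1 \<times> {0}"
  proof (intro equalityI subsetI)
    fix q assume "q \<in> F 1 ` ?K"
    then show "q \<in> sphere 0 1 \<times> {0}"
      by (auto simp: F_def cmod_def)
  next
    fix q :: "complex \<times> real" assume q: "q \<in> sphere 0 1 \<times> {0}"
    \<comment> \<open>The quarter turn sends height \<open>h\<close> to imaginary part
      \<open>- h\<close>, hence the sign.\<close>
    define t where "t = arccos (- Im (fst q)) / pi"
    have n: "(Re (fst q))\<^sup>2 + (Im (fst q))\<^sup>2 = 1" using q by (auto simp: cmod_def)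
    then have im: "\<bar>Im (fst q)\<bar> \<le> 1" using zero_le_power2[of "Re (fst q)"] unfolding abs_square_le_1[symmetric] by linarith
    have t: "t \<in> {0..1}" using im arccos_lbound[of "- Im (fst q)"] arccos_ubound[of "- Im (fst q)"]
      by (auto simp: t_def)
    have c: "cos (pi * t) = - Im (fst q)" using im by (simp add: t_def)
    have "sin (pi * t) = sqrt (1 - (Im (fst q))\<^sup>2)"
      using im sin_arccos_abs[of "- Im (fst q)"] by (simp add: t_def)
    also have "\<dots> = \<bar>Re (fst q)\<bar>" using n by (metis add_diff_cancel_right' real_sqrt_abs)
    finally have s: "sin (pi * t) = \<bar>Re (fst q)\<bar>" .
    show "q \<in> F 1 ` ?K"
    proof (cases "Re (fst q) \<ge> 0")
      case True
      have "q = F 1 (complex_of_real (sin (pi * t)), cos (pi * t))"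
        using q True by (auto simp: F_def c s complex_eq_iff prod_eq_iff)
      then show ?thesis using t by blast
    next
      case False
      have "q = F 1 (- complex_of_real (sin (pi * t)), cos (pi * t))"
        using q False by (auto simp: F_def c s complex_eq_iff prod_eq_iff)
      then show ?thesis using t by blast
    qed
  qed
  show ?thesis unfolding trivial_knot_def
  proof (rule ambient_isotopicI[of F "\<lambda>t. F (- t)"])
    show "F t (F (- t) x) = x" for t x using inv[of "- t"] by simp
    show "continuous_on ({0..1} \<times> UNIV) (\<lambda>p. F (fst p) (snd p))"
      unfolding F_def by (intro continuous_intros)
    show "continuous_on UNIV (F (- t))" for t
      unfolding F_def by (intro continuous_intros)
    show "F 0 p = p" for p
      by (simp add: F_def complex_eq_iff prod_eq_iff)
  qed (fact inv F1)+
qed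

text \<open>At each level \<open>c\<close> is the midpoint of the strands and \<open>w\<close> half
  of their difference, divided by the sine. The argument of \<open>w\<close> records how the strands
  twist about each other. Over an interval \<open>w\<close> has a continuous logarithm
  \<open>L\<close>, and scaling \<open>c\<close> and \<open>L\<close> by the time joins the
  straightening map to the identity.\<close>

lemma trivial_knot_two_strands_aux:
  fixes c w :: "real \<Rightarrow> complex"
  assumes c: "continuous_on {0..1} c" and w: "continuous_on {0..1} w"
    and w0: "\<And>t. t \<in> {0..1} \<Longrightarrow> w t \<noteq> 0"
  shows "trivial_knot ((\<lambda>t. (c t + of_real (sin (pi * t)) * w t, cos (pi * t))) ` {0..1} \<union>
     (\<lambda>t. (c t - of_real (sin (pi * t)) * w t, cos (pi * t))) ` {0..1})" (is "trivial_knot ?K")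
proof -
  obtain L where L: "continuous_on {0..1} L" and wL: "\<And>t. t \<in> {0..1} \<Longrightarrow> w t = exp (L t)"
    using continuous_logarithm_on_contractible[OF w] w0
    by (metis convex_imp_contractible convex_real_interval(5))
  \<comment> \<open>Recovers the parameter from the height; clamping extends the map to all levels
    of space.\<close>
  define s where "s = (\<lambda>h::real. arccos (max (-1) (min 1 h)) / pi)"
  have s01: "s h \<in> {0..1}" for h
    using arccos_lbound[of "max (-1) (min 1 h)"] arccos_ubound[of "max (-1) (min 1 h)"]
    by (auto simp: s_def)
  have sc: "continuous_on UNIV s"
    unfolding s_def by (intro continuous_intros) auto
  have sh: "s (cos (pi * t)) = t" if "t \<in> {0..1}" for t
  proof -
    have "0 \<le> pi * t" "pi * t \<le> pi" using that by auto
    then show ?thesis by (simp add: s_def arccos_cos)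
  qed
  have cs: "continuous_on UNIV (\<lambda>h. c (s h))" and Ls: "continuous_on UNIV (\<lambda>h. L (s h))"
    using s01 by (auto intro!: continuous_on_compose2[OF c sc] continuous_on_compose2[OF L sc])
  define F where "F = (\<lambda>t (p::complex \<times> real).
    ((fst p - of_real t * c (s (snd p))) * exp (- (of_real t * L (s (snd p)))), snd p))"
  define G where "G = (\<lambda>t (p::complex \<times> real).
    (fst p * exp (of_real t * L (s (snd p))) + of_real t * c (s (snd p)), snd p))"
  let ?K' = "(\<lambda>t. (complex_of_real (sin (pi * t)), cos (pi * t))) ` {0..1} \<union>
     (\<lambda>t. (- complex_of_real (sin (pi * t)), cos (pi * t))) ` {0..1}"
  have "ambient_isotopic ?K ?K'"
  proof (rule ambient_isotopicI[of F G])
    show "continuous_on ({0..1} \<times> UNIV) (\<lambda>p. F (fst p) (snd p))"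
      unfolding F_def
      by (intro continuous_intros continuous_on_compose2[OF cs] continuous_on_compose2[OF Ls]) auto
    show "continuous_on UNIV (G t)" for t
      unfolding G_def
      by (intro continuous_intros continuous_on_compose2[OF cs] continuous_on_compose2[OF Ls]) auto
    have "F 1 (c t + of_real (sin (pi * t)) * w t, cos (pi * t)) = (of_real (sin (pi * t)), cos (pi * t))"
         "F 1 (c t - of_real (sin (pi * t)) * w t, cos (pi * t)) = (- of_real (sin (pi * t)), cos (pi * t))"
      if "t \<in> {0..1}" for t
      using that by (simp_all add: F_def sh wL exp_minus)
    then show "F 1 ` ?K = ?K'"
      unfolding image_Un image_image by (intro arg_cong2[where f="(\<union>)"] image_cong refl)
    show "G t (F t p) = p" for t p
      by (simp add: F_def G_def mult.assoc flip: exp_add)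
    show "F t (G t p) = p" for t p
      by (simp add: F_def G_def mult.assoc flip: exp_add)
  qed (simp add: F_def)
  then show ?thesis
    using trivial_knot_round_circle ambient_isotopic_trans unfolding trivial_knot_def by blast
qed

text \<open>The value at \<open>0\<close> is the limit, read off from the derivative of the sine.
  The quotient blows up at \<open>1\<close>, so the other extremum is treated through
  \<open>1 - t\<close>.\<close>

lemma continuous_on_id_over_sin:
  "continuous_on {0..<1} (\<lambda>t::real. if t = 0 then 1 / pi else t / sin (pi * t))"
proof -
  let ?f = "\<lambda>t::real. if t = 0 then 1 / pi else t / sin (pi * t)"
  have "isCont ?f t" if "t \<in> {0..<1}" for t
  proof (cases "t = 0")
    case True
    have "((\<lambda>t. sin (pi * t)) has_real_derivative pi) (at 0)"
      by (auto intro!: derivative_eq_intros)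
    then have "((\<lambda>t. sin (pi * t) / t) \<longlongrightarrow> pi) (at 0)"
      by (simp add: has_field_derivative_iff)
    then have "((\<lambda>t. 1 / (sin (pi * t) / t)) \<longlongrightarrow> 1 / pi) (at 0)"
      by (intro tendsto_intros) auto
    then have "(?f \<longlongrightarrow> 1 / pi) (at 0)"
      by (rule Lim_transform_eventually) (auto simp: eventually_at_filter)
    then show ?thesis using True by (simp add: isCont_def)
  next
    case False
    then have t: "0 < t" "t < 1" using that by auto
    then have s: "sin (pi * t) \<noteq> 0" using sin_gt_zero[of "pi * t"] by auto
    have "isCont (\<lambda>t. t / sin (pi * t)) t" using s by (intro continuous_intros) auto
    moreover have "\<forall>\<^sub>F x in nhds t. ?f x = x / sin (pi * x)"
      using t by (auto simp: eventually_nhds intro!: exI[of _ "{0<..}"])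
    ultimately show ?thesis by (simp add: isCont_cong)
  qed
  then show ?thesis by (simp add: continuous_at_imp_continuous_on)
qed

text \<open>Near both ends the difference of the strands is linear in the parameter, so its quotient
  by the sine has a nonzero limit. In between it is nonzero because the strands do not meet at equal
  height.\<close>

lemma trivial_knot_two_strands:
  fixes \<alpha> \<beta> :: "real \<Rightarrow> complex"
  assumes \<alpha>: "continuous_on {0..1} \<alpha>" and \<beta>: "continuous_on {0..1} \<beta>"
    and ne: "\<And>t. 0 < t \<Longrightarrow> t < 1 \<Longrightarrow> \<alpha> t \<noteq> \<beta> t"
    and e: "0 < e" "e < 1/2" and d: "d \<noteq> 0" "d' \<noteq> 0"
    and start: "\<And>t. t \<in> {0..e} \<Longrightarrow> \<alpha> t - \<beta> t = of_real t * d"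
    and finish: "\<And>t. t \<in> {0..e} \<Longrightarrow> \<alpha> (1 - t) - \<beta> (1 - t) = of_real t * d'"
  shows "trivial_knot ((\<lambda>t. (\<alpha> t, cos (pi * t))) ` {0..1} \<union> (\<lambda>t. (\<beta> t, cos (pi * t))) ` {0..1})"
proof -
  define k where "k = (\<lambda>t::real. if t = 0 then 1 / pi else t / sin (pi * t))"
  define w where "w = (\<lambda>t. if t \<le> e then of_real (k t) * d / 2
    else if t \<ge> 1 - e then of_real (k (1 - t)) * d' / 2
    else (\<alpha> t - \<beta> t) / of_real (2 * sin (pi * t)))"
  have sin_pos: "sin (pi * t) > 0" if "0 < t" "t < 1" for t
    using that by (intro sin_gt_zero) auto
  have k_pos: "k t > 0" and k_sin: "sin (pi * t) * k t = t" if "0 \<le> t" "t < 1" for t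
    using that sin_pos[of t] by (cases "t = 0"; force simp: k_def)+
  have kc: "continuous_on {0..<1} k"
    unfolding k_def by (rule continuous_on_id_over_sin)
  have sin1: "sin (pi * (1 - t)) = sin (pi * t)" for t
    by (simp add: right_diff_distrib sin_diff)
  have w1: "w (1 - t) = of_real (k t) * d' / 2" if "t \<in> {0..e}" for t
    using that e by (auto simp: w_def)
  have sw: "of_real (sin (pi * t)) * w t = (\<alpha> t - \<beta> t) / 2" if t: "t \<in> {0..1}" for t
  proof -
    consider "t \<le> e" | "t \<ge> 1 - e" | "e < t" "t < 1 - e" by linarith
    then show ?thesis
    proof cases
      case 1
      then have "of_real (sin (pi * t)) * w t = of_real (sin (pi * t) * k t) * d / 2"
        by (simp add: w_def)
      also have "\<dots> = (\<alpha> t - \<beta> t) / 2"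
        using 1 t e start[of t] by (subst k_sin) auto
      finally show ?thesis .
    next
      case 2
      define s where "s = 1 - t"
      have s: "s \<in> {0..e}" "t = 1 - s" using 2 t by (auto simp: s_def)
      have "of_real (sin (pi * t)) * w t = of_real (sin (pi * s) * k s) * d' / 2"
        using s by (simp add: w1 sin1)
      also have "\<dots> = (\<alpha> t - \<beta> t) / 2"
        using s e finish[of s] by (subst k_sin) auto
      finally show ?thesis .
    next
      case 3
      then show ?thesis using sin_pos[of t] e by (simp add: w_def)
    qed
  qed
  have "w t \<noteq> 0" if t: "t \<in> {0..1}" for t
  proof -
    consider "t \<le> e" | "t \<ge> 1 - e" | "e < t" "t < 1 - e" by linarith
    then show ?thesis
    proof cases
      case 1
      then show ?thesis using t e d k_pos[of t] by (simp add: w_def)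
    next
      case 2
      then have "w t = of_real (k (1 - t)) * d' / 2" using t w1[of "1 - t"] by simp
      moreover have "of_real (k (1 - t)) * d' / 2 \<noteq> 0" using 2 t e d k_pos[of "1 - t"] by simp
      ultimately show ?thesis by metis
    next
      case 3
      then show ?thesis using sin_pos[of t] e ne[of t] by (simp add: w_def)
    qed
  qed
  moreover have "continuous_on {0..1} w"
  proof -
    have "continuous_on {0..e} w"
    proof (rule continuous_on_eq)
      show "continuous_on {0..e} (\<lambda>t. of_real (k t) * d / 2)"
        using e by (intro continuous_intros continuous_on_subset[OF kc]) auto
    qed (auto simp: w_def)
    moreover have "continuous_on {1 - e..1} w"
    proof (rule continuous_on_eq)
      show "continuous_on {1 - e..1} (\<lambda>t. of_real (k (1 - t)) * d' / 2)"
        using e by (intro continuous_intros continuous_on_compose2[OF kc]) auto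
    qed (use w1[of "1 - t" for t] in \<open>force\<close>)
    moreover have "continuous_on {e..1 - e} w"
    proof (rule continuous_on_eq)
      show "continuous_on {e..1 - e} (\<lambda>t. (\<alpha> t - \<beta> t) / of_real (2 * sin (pi * t)))"
        using e sin_pos
        by (intro continuous_intros continuous_on_subset[OF \<alpha>] continuous_on_subset[OF \<beta>])
           (auto simp: less_le)
      \<comment> \<open>The ends of this closed interval belong to the other two branches of
        \<open>w\<close>; \<open>sw\<close> shows that the branches agree there.\<close>
      show "(\<alpha> t - \<beta> t) / of_real (2 * sin (pi * t)) = w t" if "t \<in> {e..1 - e}" for t
        using sw[of t] sin_pos[of t] that e by (simp add: field_simps)
    qed
    ultimately have "continuous_on ({0..e} \<union> ({e..1 - e} \<union> {1 - e..1})) w"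
      by (intro continuous_on_closed_Un closed_Un) auto
    also have "{0..e} \<union> ({e..1 - e} \<union> {1 - e..1}) = {0..1}" using e by auto
    finally show ?thesis .
  qed
  moreover have "continuous_on {0..1} (\<lambda>t. (\<alpha> t + \<beta> t) / 2)"
    using \<alpha> \<beta> by (intro continuous_intros) auto
  ultimately have "trivial_knot
     ((\<lambda>t. ((\<alpha> t + \<beta> t) / 2 + of_real (sin (pi * t)) * w t, cos (pi * t))) ` {0..1} \<union>
      (\<lambda>t. ((\<alpha> t + \<beta> t) / 2 - of_real (sin (pi * t)) * w t, cos (pi * t))) ` {0..1})"
    by (intro trivial_knot_two_strands_aux)
  also have "(\<lambda>t. ((\<alpha> t + \<beta> t) / 2 + of_real (sin (pi * t)) * w t, cos (pi * t))) ` {0..1} =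
      (\<lambda>t. (\<alpha> t, cos (pi * t))) ` {0..1}"
    by (intro image_cong refl) (simp only: sw, simp add: field_simps)
  also have "(\<lambda>t. ((\<alpha> t + \<beta> t) / 2 - of_real (sin (pi * t)) * w t, cos (pi * t))) ` {0..1} =
      (\<lambda>t. (\<beta> t, cos (pi * t))) ` {0..1}"
    by (intro image_cong refl) (simp only: sw, simp add: field_simps)
  finally show ?thesis .
qed

text \<open>Running the strands backwards changes the sign of \<open>cos (pi * t)\<close> and
  exchanges \<open>d\<close> and \<open>d'\<close>.\<close>

lemma trivial_knot_two_strands_signed:
  fixes \<alpha> \<beta> :: "real \<Rightarrow> complex" and \<sigma> :: real
  assumes \<alpha>: "continuous_on {0..1} \<alpha>" and \<beta>: "continuous_on {0..1} \<beta>"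
    and ne: "\<And>t. 0 < t \<Longrightarrow> t < 1 \<Longrightarrow> \<alpha> t \<noteq> \<beta> t"
    and e: "0 < e" "e < 1/2" and d: "d \<noteq> 0" "d' \<noteq> 0"
    and start: "\<And>t. t \<in> {0..e} \<Longrightarrow> \<alpha> t - \<beta> t = of_real t * d"
    and finish: "\<And>t. t \<in> {0..e} \<Longrightarrow> \<alpha> (1 - t) - \<beta> (1 - t) = of_real t * d'"
    and \<sigma>: "\<sigma> = 1 \<or> \<sigma> = - 1"
  shows "trivial_knot ((\<lambda>t. (\<alpha> t, \<sigma> * cos (pi * t))) ` {0..1} \<union>
    (\<lambda>t. (\<beta> t, \<sigma> * cos (pi * t))) ` {0..1})"
  using \<sigma>
proof
  assume "\<sigma> = 1"
  then show ?thesis using trivial_knot_two_strands[OF assms(1-9)] by simp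
next
  assume \<sigma>: "\<sigma> = - 1"
  have cos1: "cos (pi * (1 - t)) = - cos (pi * t)" for t
    by (simp add: right_diff_distrib cos_diff)
  have im: "(\<lambda>t. (f (1 - t), cos (pi * t))) ` {0..1} = (\<lambda>t. (f t, - cos (pi * t))) ` {0..1}"
    for f :: "real \<Rightarrow> complex"
  proof -
    have eq: "(\<lambda>t::real. 1 - t) ` {0..1} = {0..1}"
      by simp
    show ?thesis
      by (subst (2) eq[symmetric]) (simp only: image_image cos1 minus_minus)
  qed
  have "trivial_knot ((\<lambda>t. (\<alpha> (1 - t), cos (pi * t))) ` {0..1} \<union> (\<lambda>t. (\<beta> (1 - t), cos (pi * t))) ` {0..1})"
    by (rule trivial_knot_two_strands[OF _ _ _ e d(2,1)])
       (use ne start finish in \<open>auto intro!: continuous_on_compose2[OF \<alpha>] continuous_on_compose2[OF \<beta>] continuous_intros\<close>)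
  then show ?thesis
    unfolding im using \<sigma> by simp
qed

section \<open>Three arcs with three crossings\<close>

text \<open>The heights along the arcs are exchanged for \<open>\<sigma> * cos (pi * t)\<close>, where the concatenation
  of \<open>b1\<close> and \<open>b2\<close> is parametrised by a single \<open>t\<close>.\<close>

lemma trivial_knot_three_arcs_aux:
  fixes \<alpha> b1 b2 :: "real \<Rightarrow> complex" and Ha H1 H2 :: "complex \<Rightarrow> real" and \<sigma> :: real
  assumes arcs: "arc \<alpha>" "arc b1" "arc b2"
    and ends: "pathstart \<alpha> = T" "pathstart b1 = T" "pathfinish \<alpha> = B" "pathfinish b2 = B"
      "pathfinish b1 = M" "pathstart b2 = M"
    and inter: "path_image \<alpha> \<inter> path_image b1 = {T, x}" "path_image \<alpha> \<inter> path_image b2 = {B, y}"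
      "path_image b1 \<inter> path_image b2 = {M, w}"
    and params: "\<alpha> u = x" "\<alpha> u' = y" "b1 q = x" "b1 r = w" "b2 r' = w" "b2 q' = y"
    and order: "0 < u" "u < 1" "0 < u'" "u' < 1" "0 < q" "q < r" "r < 1" "0 < r'" "r' < q'" "q' < 1"
    and H: "continuous_on (path_image \<alpha>) Ha" "continuous_on (path_image b1) H1"
      "continuous_on (path_image b2) H2"
    and joint: "Ha T = H1 T" "Ha B = H2 B" "H1 M = H2 M"
    and \<sigma>: "\<sigma> = 1 \<or> \<sigma> = - 1"
    and x: "\<sigma> * (Ha x - H1 x) * (q / 2 - u) > 0"
    and y: "\<sigma> * (Ha y - H2 y) * ((1 + q') / 2 - u') > 0"
    and w: "\<sigma> * (H1 w - H2 w) > 0"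
    and e: "0 < e" "e < 1/2" and d: "d \<noteq> 0" "d' \<noteq> 0"
    and start: "\<And>t. t \<in> {0..e} \<Longrightarrow> \<alpha> t - b1 (2 * t) = of_real t * d"
    and finish: "\<And>t. t \<in> {0..e} \<Longrightarrow> \<alpha> (1 - t) - b2 (1 - 2 * t) = of_real t * d'"
  shows "trivial_knot ((\<lambda>z. (z, Ha z)) ` path_image \<alpha> \<union> (\<lambda>z. (z, H1 z)) ` path_image b1 \<union>
    (\<lambda>z. (z, H2 z)) ` path_image b2)"
proof -
  have at01: "\<alpha> 0 = T" "b1 0 = T" "\<alpha> 1 = B" "b2 1 = B" "b1 1 = M" "b2 0 = M"
    using ends by (auto simp: pathstart_def pathfinish_def)
  have inj: "inj_on \<alpha> {0..1}" "inj_on b1 {0..1}" "inj_on b2 {0..1}"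
    using arcs by (auto simp: arc_def)
  have inj\<alpha>: "s = t" if "\<alpha> s = \<alpha> t" "s \<in> {0..1}" "t \<in> {0..1}" for s t
    using inj_onD[OF inj(1) that] .
  have inj1: "s = t" if "b1 s = b1 t" "s \<in> {0..1}" "t \<in> {0..1}" for s t
    using inj_onD[OF inj(2) that] .
  have inj2: "s = t" if "b2 s = b2 t" "s \<in> {0..1}" "t \<in> {0..1}" for s t
    using inj_onD[OF inj(3) that] .
  have img: "\<alpha> t \<in> path_image \<alpha>" "b1 t \<in> path_image b1" "b2 t \<in> path_image b2" if "t \<in> {0..1}" for t
    using that by (auto simp: path_image_def)
  have "x \<noteq> w" using inj1[of q r] params order by auto
  moreover have "y \<noteq> w" using inj2[of r' q'] params order by auto
  moreover have "x \<noteq> y"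
  proof
    assume "x = y"
    then have "x \<in> {M, w}" using inter(3) inter(1,2) by auto
    then have "b1 q = b1 1" using \<open>x \<noteq> w\<close> params at01 by auto
    then show False using inj1[of q 1] order by auto
  qed
  ultimately have distinct: "x \<noteq> w" "y \<noteq> w" "x \<noteq> y" by auto
  define s where "s = (\<lambda>t. \<sigma> * cos (pi * t))"
  \<comment> \<open>Earlier points are higher if \<sigma> is \<open>1\<close> and lower if it is
    \<open>- 1\<close>.\<close>
  have s_less: "\<sigma> * (s t - s t') > 0" if "0 \<le> t" "t < t'" "t' \<le> 1" for t t'
    using cos_monotone_0_pi[of "pi * t" "pi * t'"] that \<sigma> by (auto simp: s_def)
  have sc: "continuous_on A s" for A
    unfolding s_def by (intro continuous_intros)
  obtain ia where ia: "homeomorphism {0..1} (path_image \<alpha>) \<alpha> ia" using homeomorphism_arc arcs(1) by blast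
  obtain i1 where i1: "homeomorphism {0..1} (path_image b1) b1 i1" using homeomorphism_arc arcs(2) by blast
  obtain i2 where i2: "homeomorphism {0..1} (path_image b2) b2 i2" using homeomorphism_arc arcs(3) by blast
  have inv: "ia (\<alpha> t) = t" "i1 (b1 t) = t" "i2 (b2 t) = t" if "t \<in> {0..1}" for t
    using that ia i1 i2 by (auto simp: homeomorphism_def)
  define Ka where "Ka = (\<lambda>z. s (ia z))"
  define K1 where "K1 = (\<lambda>z. s (i1 z / 2))"
  define K2 where "K2 = (\<lambda>z. s ((1 + i2 z) / 2))"
  have K: "continuous_on (path_image \<alpha>) Ka" "continuous_on (path_image b1) K1"
      "continuous_on (path_image b2) K2"
    unfolding Ka_def K1_def K2_def using ia i1 i2
    by (auto simp: homeomorphism_def intro!: continuous_on_compose2[OF sc[of UNIV]] continuous_intros)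
  have Kt: "Ka (\<alpha> t) = s t" "K1 (b1 t) = s (t / 2)" "K2 (b2 t) = s ((1 + t) / 2)" if "t \<in> {0..1}" for t
    using that by (simp_all add: Ka_def K1_def K2_def inv)
  \<comment> \<open>The sign of \<open>q / 2 - u\<close> tells which strand reaches \<open>x\<close>
    first, and so which one is upper for the new heights. The hypothesis on \<open>x\<close> says
    that this agrees with the old heights.\<close>
  have kx: "(Ka x - K1 x) / (Ha x - H1 x) > 0"
  proof -
    have eq: "Ka x = s u" "K1 x = s (q / 2)"
      using Kt[of u] Kt[of q] order params by auto
    show ?thesis
    proof (cases "u < q / 2")
      case True
      then have "\<sigma> * (Ha x - H1 x) > 0" using x by (simp add: zero_less_mult_iff)
      then show ?thesis using s_less[of u "q / 2"] True order \<sigma> by (auto simp: eq zero_less_divide_iff)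
    next
      case False
      then have "\<sigma> * (Ha x - H1 x) < 0" "q / 2 < u" using x[unfolded zero_less_mult_iff[of "\<sigma> * (Ha x - H1 x)"]] by linarith+
      then show ?thesis using s_less[of "q / 2" u] order \<sigma> by (auto simp: eq zero_less_divide_iff)
    qed
  qed
  have ky: "(Ka y - K2 y) / (Ha y - H2 y) > 0"
  proof -
    have eq: "Ka y = s u'" "K2 y = s ((1 + q') / 2)"
      using Kt[of u'] Kt[of q'] order params by auto
    show ?thesis
    proof (cases "u' < (1 + q') / 2")
      case True
      then have "\<sigma> * (Ha y - H2 y) > 0" using y by (simp add: zero_less_mult_iff)
      then show ?thesis using s_less[of u' "(1 + q') / 2"] True order \<sigma> by (auto simp: eq zero_less_divide_iff)
    next
      case False
      then have "\<sigma> * (Ha y - H2 y) < 0" "(1 + q') / 2 < u'" using y[unfolded zero_less_mult_iff[of "\<sigma> * (Ha y - H2 y)"]] by linarith+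
      then show ?thesis using s_less[of "(1 + q') / 2" u'] order \<sigma> by (auto simp: eq zero_less_divide_iff)
    qed
  qed
  have kw: "(K1 w - K2 w) / (H1 w - H2 w) > 0"
  proof -
    have eq: "K1 w = s (r / 2)" "K2 w = s ((1 + r') / 2)"
      using Kt[of r] Kt[of r'] order params by auto
    show ?thesis
      using s_less[of "r / 2" "(1 + r') / 2"] order \<sigma> w by (auto simp: eq zero_less_divide_iff)
  qed
  have KT: "Ka T = K1 T" and KB: "Ka B = K2 B" and KM: "K1 M = K2 M"
    using Kt[of 0] Kt[of 1] by (simp_all add: at01)
  \<comment> \<open>The ratio of new to old height difference at each crossing; positivity lets its
    logarithm serve as \<nu>. At the joints both differences vanish and nothing is
    prescribed.\<close>
  define \<mu> where "\<mu> = (\<lambda>z. if z = x then (Ka x - K1 x) / (Ha x - H1 x)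
    else if z = y then (Ka y - K2 y) / (Ha y - H2 y) else (K1 w - K2 w) / (H1 w - H2 w))"
  obtain \<nu> where \<nu>: "continuous_on UNIV \<nu>" and \<nu>x: "\<And>z. z \<in> {x, y, w} \<Longrightarrow> \<nu> z = ln (\<mu> z)"
    using finite_real_interpolation[of "{x, y, w}" "\<lambda>z. ln (\<mu> z)"] by blast
  have exp_mult: "a = exp (ln (a / b)) * b" if "a / b > 0" for a b :: real
    using that by (cases "b = 0") auto
  have ea1: "Ka z - K1 z = exp (\<nu> z) * (Ha z - H1 z)" if "z \<in> path_image \<alpha>" "z \<in> path_image b1" for z
  proof -
    have "z = T \<or> z = x" using inter(1) that by auto
    then show ?thesis using exp_mult[OF kx] \<nu>x[of x] \<mu>_def KT joint by auto
  qed
  have ea2: "Ka z - K2 z = exp (\<nu> z) * (Ha z - H2 z)" if "z \<in> path_image \<alpha>" "z \<in> path_image b2" for z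
  proof -
    have "z = B \<or> z = y" using inter(2) that by auto
    then show ?thesis using exp_mult[OF ky] \<nu>x[of y] \<mu>_def KB joint distinct by auto
  qed
  have e12: "K1 z - K2 z = exp (\<nu> z) * (H1 z - H2 z)" if "z \<in> path_image b1" "z \<in> path_image b2" for z
  proof -
    have "z = M \<or> z = w" using inter(3) that by auto
    then show ?thesis using exp_mult[OF kw] \<nu>x[of w] \<mu>_def KM joint distinct by auto
  qed
  define \<Gamma> where "\<Gamma> = (!) [path_image \<alpha>, path_image b1, path_image b2]"
  define G where "G = (!) [Ha, H1, H2]"
  define G' where "G' = (!) [Ka, K1, K2]"
  let ?I = "{0, 1, 2 :: nat}"
  have iso: "ambient_isotopic (\<Union>i\<in>?I. (\<lambda>z. (z, G i z)) ` \<Gamma> i) (\<Union>i\<in>?I. (\<lambda>z. (z, G' i z)) ` \<Gamma> i)"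
  proof (rule ambient_isotopic_graphs[OF _ _ _ _ \<nu>])
    show "closed (\<Gamma> i)" if "i \<in> ?I" for i
      using that arcs by (auto simp: \<Gamma>_def closed_arc_image)
    show "continuous_on (\<Gamma> i) (G i)" "continuous_on (\<Gamma> i) (G' i)" if "i \<in> ?I" for i
      using that H K by (auto simp: \<Gamma>_def G_def G'_def)
    show "G' i z - G' j z = exp (\<nu> z) * (G i z - G j z)"
      if "i \<in> ?I" "j \<in> ?I" "z \<in> \<Gamma> i" "z \<in> \<Gamma> j" for i j z
      using that ea1[of z] ea2[of z] e12[of z]
      by (auto simp: \<Gamma>_def G_def G'_def algebra_simps)
  qed simp
  have eq: "(\<Union>i\<in>?I. (\<lambda>z. (z, G i z)) ` \<Gamma> i) = (\<lambda>z. (z, Ha z)) ` path_image \<alpha> \<union>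
      (\<lambda>z. (z, H1 z)) ` path_image b1 \<union> (\<lambda>z. (z, H2 z)) ` path_image b2"
    by (simp add: \<Gamma>_def G_def Un_assoc)
  have eq': "(\<Union>i\<in>?I. (\<lambda>z. (z, G' i z)) ` \<Gamma> i) = (\<lambda>t. (\<alpha> t, \<sigma> * cos (pi * t))) ` {0..1} \<union>
      (\<lambda>t. ((b1 +++ b2) t, \<sigma> * cos (pi * t))) ` {0..1}"
  proof -
    have "(\<lambda>z. (z, Ka z)) ` path_image \<alpha> = (\<lambda>t. (\<alpha> t, \<sigma> * cos (pi * t))) ` {0..1}"
      unfolding path_image_def image_image by (intro image_cong refl) (simp add: Kt s_def)
    moreover have "(\<lambda>z. (z, K1 z)) ` path_image b1 = (\<lambda>t. (b1 t, s (t / 2))) ` {0..1}"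
      unfolding path_image_def image_image by (intro image_cong refl) (simp add: Kt)
    moreover have "(\<lambda>z. (z, K2 z)) ` path_image b2 = (\<lambda>t. (b2 t, s ((1 + t) / 2))) ` {0..1}"
      unfolding path_image_def image_image by (intro image_cong refl) (simp add: Kt)
    moreover have "(\<lambda>t. ((b1 +++ b2) t, s t)) ` {0..1} =
        (\<lambda>t. (b1 t, s (t / 2))) ` {0..1} \<union> (\<lambda>t. (b2 t, s ((1 + t) / 2))) ` {0..1}"
      (is "?L = ?R1 \<union> ?R2")
    proof (intro equalityI subsetI)
      fix p assume "p \<in> ?L"
      then obtain t where t: "t \<in> {0..1}" "p = ((b1 +++ b2) t, s t)" by auto
      show "p \<in> ?R1 \<union> ?R2"
      proof (cases "t \<le> 1/2")
        case True
        then have "p = (b1 (2 * t), s (2 * t / 2))" "2 * t \<in> {0..1}" using t by (auto simp: joinpaths_def)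
        then show ?thesis by blast
      next
        case False
        then have "p = (b2 (2 * t - 1), s ((1 + (2 * t - 1)) / 2))" "2 * t - 1 \<in> {0..1}"
          using t by (auto simp: joinpaths_def)
        then show ?thesis by blast
      qed
    next
      fix p assume "p \<in> ?R1 \<union> ?R2"
      then consider t where "t \<in> {0..1}" "p = (b1 t, s (t / 2))"
        | t where "t \<in> {0..1}" "p = (b2 t, s ((1 + t) / 2))" by auto
      then show "p \<in> ?L"
      proof cases
        case 1
        then have "p = ((b1 +++ b2) (t / 2), s (t / 2))" "t / 2 \<in> {0..1}" by (auto simp: joinpaths_def)
        then show ?thesis by blast
      next
        case 2
        then have "p = ((b1 +++ b2) ((1 + t) / 2), s ((1 + t) / 2))" "(1 + t) / 2 \<in> {0..1}"
          using at01 by (auto simp: joinpaths_def field_simps)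
        then show ?thesis by blast
      qed
    qed
    ultimately show ?thesis
      by (simp add: \<Gamma>_def G'_def s_def)
  qed
  have "trivial_knot ((\<lambda>t. (\<alpha> t, \<sigma> * cos (pi * t))) ` {0..1} \<union>
      (\<lambda>t. ((b1 +++ b2) t, \<sigma> * cos (pi * t))) ` {0..1})"
  proof (rule trivial_knot_two_strands_signed[OF _ _ _ _ _ d _ _ \<sigma>])
    show "continuous_on {0..1} \<alpha>" using arcs by (simp add: arc_def path_def)
    have "path (b1 +++ b2)" using arcs ends by (simp add: arc_imp_path)
    then show "continuous_on {0..1} (b1 +++ b2)" by (simp add: path_def)
    show "0 < e / 2" "e / 2 < 1/2" using e by auto
    show "\<alpha> t - (b1 +++ b2) t = of_real t * d" if "t \<in> {0..e / 2}" for t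
      using start[of t] that e by (auto simp: joinpaths_def)
    show "\<alpha> (1 - t) - (b1 +++ b2) (1 - t) = of_real t * d'" if "t \<in> {0..e / 2}" for t
      using finish[of t] that e by (auto simp: joinpaths_def algebra_simps)
    \<comment> \<open>A common point at equal parameters inside the interval would be a crossing
      that both strands reach simultaneously, that is \<open>u = q / 2\<close> or
      \<open>u' = (1 + q') / 2\<close>. The strict sign conditions at \<open>x\<close> and
      \<open>y\<close> forbid this.\<close>
    show "\<alpha> t \<noteq> (b1 +++ b2) t" if t: "0 < t" "t < 1" for t
    proof
      assume eq: "\<alpha> t = (b1 +++ b2) t"
      show False
      proof (cases "t \<le> 1/2")
        case True
        then have eq: "\<alpha> t = b1 (2 * t)" using eq by (simp add: joinpaths_def)
        then have "\<alpha> t \<in> {T, x}" using inter(1) img(1)[of t] img(2)[of "2 * t"] t True by auto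
        then have "\<alpha> t = \<alpha> 0 \<or> \<alpha> t = \<alpha> u \<and> b1 (2 * t) = b1 q"
          using at01 params eq by auto
        then have "t = u \<and> 2 * t = q"
          using inj\<alpha>[of t 0] inj\<alpha>[of t u] inj1[of "2 * t" q] t True order by auto
        then have "q / 2 - u = 0" by auto
        then show False using x by simp
      next
        case False
        then have eq: "\<alpha> t = b2 (2 * t - 1)" using eq by (simp add: joinpaths_def)
        then have "\<alpha> t \<in> {B, y}" using inter(2) img(1)[of t] img(3)[of "2 * t - 1"] t False by auto
        then have "\<alpha> t = \<alpha> 1 \<or> \<alpha> t = \<alpha> u' \<and> b2 (2 * t - 1) = b2 q'"
          using at01 params eq by auto
        then have "t = u' \<and> 2 * t - 1 = q'"
          using inj\<alpha>[of t 1] inj\<alpha>[of t u'] inj2[of "2 * t - 1" q'] t False order by auto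
        then have "(1 + q') / 2 - u' = 0" by auto
        then show False using y by simp
      qed
    qed
  qed
  then show ?thesis
    using iso unfolding eq eq' trivial_knot_def by (rule ambient_isotopic_trans[rotated])
qed

section \<open>Moving points along an arc\<close>

text \<open>The graph of \<open>f\<close> is the diagonal outside the interval and two segments
  meeting at \<open>(p, q)\<close> inside. For \<open>p \<le> q\<close> the segments form a concave
  roof over the diagonal, so \<open>f\<close> is a minimum of two lines followed by a maximum with
  the identity; otherwise minimum and maximum change places. In this form continuity and
  monotonicity are immediate.\<close>

lemma strict_mono_push:
  fixes a b p q :: real
  assumes "a < p" "p < b" "a < q" "q < b"
  obtains f where "continuous_on UNIV f" "strict_mono f" "f p = q"
    "\<And>t. t \<le> a \<Longrightarrow> f t = t" "\<And>t. b \<le> t \<Longrightarrow> f t = t"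
proof -
  define k where "k = (q - a) / (p - a)"
  define m where "m = (b - q) / (b - p)"
  have pos: "k > 0" "m > 0" using assms by (auto simp: k_def m_def)
  have kp: "k * (p - a) = q - a" and mp: "m * (b - p) = b - q"
    using assms by (auto simp: k_def m_def)
  let ?l = "\<lambda>t. a + k * (t - a)" and ?r = "\<lambda>t. b - m * (b - t)"
  have mono: "?l s < ?l t" "?r s < ?r t" if "s < t" for s t
    using that pos by auto
  show thesis
  proof (cases "p \<le> q")
    case True
    have km: "k \<ge> 1" "m \<le> 1" using True assms by (auto simp: k_def m_def field_simps)
    let ?f = "\<lambda>t. max t (min (?l t) (?r t))"
    have "?f t = t" if "t \<le> a" for t
      using mult_right_mono_neg[OF km(1), of "t - a"] that by simp
    moreover have "?f t = t" if "b \<le> t" for t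
      using mult_right_mono_neg[OF km(2), of "b - t"] that by simp
    moreover have "?f p = q" using True kp mp by simp
    moreover have "continuous_on UNIV ?f" by (intro continuous_intros)
    moreover have "strict_mono ?f"
    proof (rule strict_monoI)
      fix s t :: real assume "s < t"
      then show "?f s < ?f t" using mono[of s t] by (simp add: max_def min_def; linarith)
    qed
    ultimately show thesis using that[of ?f] by blast
  next
    case False
    have km: "k \<le> 1" "m \<ge> 1" using False assms by (auto simp: k_def m_def field_simps)
    let ?f = "\<lambda>t. min t (max (?l t) (?r t))"
    have "?f t = t" if "t \<le> a" for t
      using mult_right_mono_neg[OF km(1), of "t - a"] that by simp
    moreover have "?f t = t" if "b \<le> t" for t
      using mult_right_mono_neg[OF km(2), of "b - t"] that by simp
    moreover have "?f p = q" using False kp mp by simp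
    moreover have "continuous_on UNIV ?f" by (intro continuous_intros)
    moreover have "strict_mono ?f"
    proof (rule strict_monoI)
      fix s t :: real assume "s < t"
      then show "?f s < ?f t" using mono[of s t] by (simp add: max_def min_def; linarith)
    qed
    ultimately show thesis using that[of ?f] by blast
  qed
qed

text \<open>Two pushes are composed: the first brings \<open>u\<close> to \<open>p\<close>, the
  second fixes everything up to \<open>p\<close> and corrects the other point. Both leave the end
  pieces alone, so straight ends remain straight.\<close>

lemma arc_reparametrize_two_points:
  fixes g :: "real \<Rightarrow> 'a::t2_space"
  assumes g: "arc g" and p: "0 < p" "p < p'" "p' < 1" and u: "0 < u" "u < u'" "u' < 1"
  obtains e f where "0 < e" "arc f" "path_image f = path_image g" "f u = g p" "f u' = g p'"
    "\<And>t. t \<in> {0..e} \<Longrightarrow> f t = g t" "\<And>t. t \<in> {0..e} \<Longrightarrow> f (1 - t) = g (1 - t)"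
proof -
  define e where "e = min (min p u) (min (1 - p') (1 - u')) / 2"
  have e: "0 < e" "e < p" "e < u" "p' < 1 - e" "u' < 1 - e" using p u by (auto simp: e_def min_def field_simps)
  obtain f1 where f1: "continuous_on UNIV f1" "strict_mono f1" "f1 u = p"
      "\<And>t. t \<le> e \<Longrightarrow> f1 t = t" "\<And>t. 1 - e \<le> t \<Longrightarrow> f1 t = t"
    using strict_mono_push[of e u "1 - e" p] e p u by auto
  have "p < f1 u'" "f1 u' < 1 - e"
    using strict_monoD[OF f1(2), of u u'] strict_monoD[OF f1(2), of u' "1 - e"] f1 u e by auto
  then obtain f2 where f2: "continuous_on UNIV f2" "strict_mono f2" "f2 (f1 u') = p'"
      "\<And>t. t \<le> p \<Longrightarrow> f2 t = t" "\<And>t. 1 - e \<le> t \<Longrightarrow> f2 t = t"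
    using strict_mono_push[of p "f1 u'" "1 - e" p'] e p by auto
  let ?h = "\<lambda>t. f2 (f1 t)"
  have hc: "continuous_on A ?h" for A
    by (intro continuous_on_compose2[OF f2(1)] continuous_on_subset[OF f1(1)]) auto
  have hm: "strict_mono ?h" using f1(2) f2(2) by (auto simp: strict_mono_def)
  have h01: "?h 0 = 0" "?h 1 = 1" using f1 f2 e p by auto
  have him: "?h ` {0..1} = {0..1}"
  proof (intro equalityI subsetI)
    fix y assume "y \<in> ?h ` {0..1}"
    then show "y \<in> {0..1}"
      using strict_mono_less_eq[OF hm] h01 by (auto) (metis, metis)
  next
    fix y :: real assume "y \<in> {0..1}"
    then show "y \<in> ?h ` {0..1}"
      using IVT'[of ?h 0 y 1] h01 hc by force
  qed
  have "path (g \<circ> ?h)"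
    using g hc him unfolding arc_def path_def
    by (intro continuous_on_compose) auto
  moreover have "inj_on (g \<circ> ?h) {0..1}"
    using g him strict_mono_on_imp_inj_on[OF hm] unfolding arc_def
    by (intro comp_inj_on) (auto intro: inj_on_subset)
  ultimately have "arc (g \<circ> ?h)" by (simp add: arc_def)
  moreover have "path_image (g \<circ> ?h) = path_image g"
    unfolding path_image_def image_comp[symmetric] him ..
  ultimately show thesis
    using e p f1 f2 by (intro that[of e "g \<circ> ?h"]) auto
qed

lemma less_3_iff: "k < 3 \<longleftrightarrow> k = 0 \<or> k = 1 \<or> k = (2::nat)"
  by auto

text \<open>Arc \<open>k\<close> first meets its predecessor, at \<open>x (k - 1)\<close>, and then its successor, at
  \<open>x k\<close>.  The cyclic order of the crossings along the closed curve is therefore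
  \<open>x2 x0 x0 x1 x1 x2\<close>: the curve can be made to have a single maximum and a single minimum of the
  height, at the joints on the two sides of arc \<open>0\<close>.  The sign of the crossing \<open>x 1\<close> decides
  which one is the maximum, and those of \<open>x 2\<close> and \<open>x 0\<close> are met by moving these points along
  arc \<open>0\<close>.\<close>

lemma trivial_knot_three_arcs:
  fixes g :: "nat \<Rightarrow> real \<Rightarrow> complex" and H :: "nat \<Rightarrow> complex \<Rightarrow> real"
  assumes arcs: "\<And>k. k < 3 \<Longrightarrow> arc (g k)"
    and joined: "\<And>k. k < 3 \<Longrightarrow> pathfinish (g k) = pathstart (g (Suc k mod 3))"
    and inter: "\<And>k. k < 3 \<Longrightarrow>
      path_image (g k) \<inter> path_image (g (Suc k mod 3)) = {pathfinish (g k), x k}"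
    and v: "v \<noteq> 0"
    and straight: "\<And>k. k < 3 \<Longrightarrow> \<exists>e>0. \<exists>c>0. \<exists>c'>0. \<forall>t\<in>{0..e}.
      g k t = pathstart (g k) + of_real (c * t) * v \<and>
      g k (1 - t) = pathfinish (g k) - of_real (c' * t) * v"
    and order: "\<And>k. k < 3 \<Longrightarrow> 0 < p k \<and> p k < p' k \<and> p' k < 1"
    and params: "\<And>k. k < 3 \<Longrightarrow> g k (p k) = x ((k + 2) mod 3) \<and> g k (p' k) = x k"
    and H: "\<And>k. k < 3 \<Longrightarrow> continuous_on (path_image (g k)) (H k)"
    and joint: "\<And>k. k < 3 \<Longrightarrow> H k (pathfinish (g k)) = H (Suc k mod 3) (pathfinish (g k))"
    and crossing: "\<And>k. k < 3 \<Longrightarrow> H k (x k) \<noteq> H (Suc k mod 3) (x k)"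
  shows "trivial_knot (\<Union>k<3. (\<lambda>z. (z, H k z)) ` path_image (g k))"
proof -
  \<comment> \<open>The second strand runs arc \<open>2\<close> and then arc \<open>1\<close>, both
    backwards, so it passes \<open>x 2\<close>, \<open>x 1\<close>, \<open>x 1\<close>,
    \<open>x 0\<close> in this order.\<close>
  define q where "q = 1 - p' 2"
  define r where "r = 1 - p 2"
  define r' where "r' = 1 - p' 1"
  define q' where "q' = 1 - p 1"
  have qr: "0 < q" "q < r" "r < 1" "0 < r'" "r' < q'" "q' < 1"
    using order[of 1] order[of 2] by (auto simp: q_def r_def q'_def r'_def)
  \<comment> \<open>Both visits to \<open>x 1\<close> lie on the second strand in a fixed order, so
    only the direction of the height can match its sign.\<close>
  define \<sigma> :: real where "\<sigma> = (if H 2 (x 1) > H 1 (x 1) then 1 else - 1)"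
  have \<sigma>: "\<sigma> = 1 \<or> \<sigma> = - 1" by (simp add: \<sigma>_def)
  \<comment> \<open>The second strand reaches \<open>x 2\<close> at \<open>q / 2\<close> and
    \<open>x 0\<close> at \<open>(1 + q') / 2\<close>. Arc \<open>0\<close> is made to come before
    or after these parameters, as the signs demand; since \<open>u\<close> stays below
    \<open>1/2\<close> and \<open>u'\<close> above it, their order is kept.\<close>
  define u where "u = (if \<sigma> * (H 0 (x 2) - H 2 (x 2)) > 0 then q / 4 else (q + r) / 4)"
  define u' where "u' = (if \<sigma> * (H 0 (x 0) - H 1 (x 0)) > 0
    then (1 + (r' + q') / 2) / 2 else (1 + (1 + q') / 2) / 2)"
  have u: "0 < u" "u < u'" "u' < 1"
    using qr by (auto simp: u_def u'_def field_simps)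
  obtain f \<alpha> where f: "0 < f" and \<alpha>: "arc \<alpha>" "path_image \<alpha> = path_image (g 0)"
      "\<alpha> u = g 0 (p 0)" "\<alpha> u' = g 0 (p' 0)"
      "\<And>t. t \<in> {0..f} \<Longrightarrow> \<alpha> t = g 0 t" "\<And>t. t \<in> {0..f} \<Longrightarrow> \<alpha> (1 - t) = g 0 (1 - t)"
    by (rule arc_reparametrize_two_points[OF arcs[of 0], of "p 0" "p' 0" u u'])
       (use order[of 0] u in auto)
  have \<alpha>01: "pathstart \<alpha> = pathstart (g 0)" "pathfinish \<alpha> = pathfinish (g 0)"
    using \<alpha>(5)[of 0] \<alpha>(6)[of 0] f by (auto simp: pathstart_def pathfinish_def)
  obtain e0 c0 c0' where s0: "e0 > 0" "c0 > 0" "c0' > 0" and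
      g0: "\<And>t. t \<in> {0..e0} \<Longrightarrow> g 0 t = pathstart (g 0) + of_real (c0 * t) * v"
        "\<And>t. t \<in> {0..e0} \<Longrightarrow> g 0 (1 - t) = pathfinish (g 0) - of_real (c0' * t) * v"
    using straight[of 0] by auto
  obtain e1 c1 where s1: "e1 > 0" "c1 > 0" and
      g1: "\<And>t. t \<in> {0..e1} \<Longrightarrow> g 1 t = pathfinish (g 0) + of_real (c1 * t) * v"
    using straight[of 1] joined[of 0] by auto
  obtain e2 c2 where s2: "e2 > 0" "c2 > 0" and
      g2: "\<And>t. t \<in> {0..e2} \<Longrightarrow> g 2 (1 - t) = pathstart (g 0) - of_real (c2 * t) * v"
    using straight[of 2] joined[of 2] by auto
  define e where "e = min (min f e0) (min (min e1 e2 / 2) (1/4))"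
  have e: "0 < e" "e < 1/2" "e \<le> f" "e \<le> e0" "2 * e \<le> e1" "2 * e \<le> e2"
    using f s0 s1 s2 by (auto simp: e_def min_def field_simps)
  have "trivial_knot ((\<lambda>z. (z, H 0 z)) ` path_image \<alpha> \<union>
      (\<lambda>z. (z, H 2 z)) ` path_image (reversepath (g 2)) \<union>
      (\<lambda>z. (z, H 1 z)) ` path_image (reversepath (g 1)))"
  proof (rule trivial_knot_three_arcs_aux[where T = "pathstart (g 0)" and B = "pathfinish (g 0)"
        and M = "pathstart (g 2)" and x = "x 2" and y = "x 0" and w = "x 1" and u = u and u' = u'
        and q = q and r = r and r' = r' and q' = q' and \<sigma> = \<sigma> and e = e
        and d = "of_real (c0 + 2 * c2) * v" and d' = "- of_real (c0' + 2 * c1) * v"])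
    show "arc (reversepath (g 2))" "arc (reversepath (g 1))"
      using arcs by (simp_all add: arc_reversepath)
    show "pathstart (reversepath (g 2)) = pathstart (g 0)"
      "pathfinish (reversepath (g 1)) = pathfinish (g 0)"
      "pathfinish (reversepath (g 2)) = pathstart (g 2)"
      "pathstart (reversepath (g 1)) = pathstart (g 2)"
      using joined[of 0] joined[of 1] joined[of 2] by (simp_all add: numeral_2_eq_2)
    show "path_image \<alpha> \<inter> path_image (reversepath (g 2)) = {pathstart (g 0), x 2}"
      "path_image \<alpha> \<inter> path_image (reversepath (g 1)) = {pathfinish (g 0), x 0}"
      "path_image (reversepath (g 2)) \<inter> path_image (reversepath (g 1)) = {pathstart (g 2), x 1}"
      using inter[of 0] inter[of 1] inter[of 2] joined[of 1] joined[of 2]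
      by (simp_all add: \<alpha>(2) Int_commute numeral_2_eq_2)
    show "\<alpha> u = x 2" "\<alpha> u' = x 0" using \<alpha>(3,4) params[of 0] by (auto simp: numeral_2_eq_2)
    show "reversepath (g 2) q = x 2" "reversepath (g 2) r = x 1" "reversepath (g 1) r' = x 1"
      "reversepath (g 1) q' = x 0"
      using params[of 1] params[of 2] by (auto simp: reversepath_def q_def r_def q'_def r'_def numeral_2_eq_2)
    show "H 0 (pathstart (g 0)) = H 2 (pathstart (g 0))"
      "H 0 (pathfinish (g 0)) = H 1 (pathfinish (g 0))"
      "H 2 (pathstart (g 2)) = H 1 (pathstart (g 2))"
      using joint[of 0] joint[of 1] joint[of 2] joined[of 1] joined[of 2]
      by (simp_all add: numeral_2_eq_2)
    show "0 < \<sigma> * (H 0 (x 2) - H 2 (x 2)) * (q / 2 - u)"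
    proof (cases "\<sigma> * (H 0 (x 2) - H 2 (x 2)) > 0")
      case True
      then show ?thesis using qr by (simp add: u_def)
    next
      case False
      then have "\<sigma> * (H 0 (x 2) - H 2 (x 2)) < 0"
        using crossing[of 2] \<sigma> by (auto simp: numeral_2_eq_2)
      then show ?thesis using qr False by (simp add: u_def mult_neg_neg)
    qed
    show "0 < \<sigma> * (H 0 (x 0) - H 1 (x 0)) * ((1 + q') / 2 - u')"
    proof (cases "\<sigma> * (H 0 (x 0) - H 1 (x 0)) > 0")
      case True
      moreover have "(1 + q') / 2 - u' > 0" using qr True by (simp add: u'_def)
      ultimately show ?thesis by (rule mult_pos_pos)
    next
      case False
      then have "\<sigma> * (H 0 (x 0) - H 1 (x 0)) < 0"
        using crossing[of 0] \<sigma> by auto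
      then show ?thesis using qr False by (simp add: u'_def mult_neg_neg)
    qed
    show "0 < \<sigma> * (H 2 (x 1) - H 1 (x 1))"
      using crossing[of 1] by (auto simp: \<sigma>_def numeral_2_eq_2)
    show "of_real (c0 + 2 * c2) * v \<noteq> 0" "- of_real (c0' + 2 * c1) * v \<noteq> 0"
      using s0 s1 s2 v by (auto simp del: of_real_add of_real_mult)
    \<comment> \<open>The strands leave the joint in opposite directions, the second one at double
      speed, so the coefficients add up to \<open>c0 + 2 * c2\<close>.\<close>
    show "\<alpha> t - reversepath (g 2) (2 * t) = of_real t * (of_real (c0 + 2 * c2) * v)"
      if "t \<in> {0..e}" for t
      using that e \<alpha>(5)[of t] g0(1)[of t] g2[of "2 * t"]
      by (simp add: reversepath_def algebra_simps)
    show "\<alpha> (1 - t) - reversepath (g 1) (1 - 2 * t) = of_real t * (- of_real (c0' + 2 * c1) * v)"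
      if "t \<in> {0..e}" for t
      using that e \<alpha>(6)[of t] g0(2)[of t] g1[of "2 * t"]
      by (simp add: reversepath_def algebra_simps)
    show "continuous_on (path_image \<alpha>) (H 0)" "continuous_on (path_image (reversepath (g 2))) (H 2)"
      "continuous_on (path_image (reversepath (g 1))) (H 1)"
      using H by (simp_all add: \<alpha>(2))
  qed (use \<alpha>(1) \<alpha>01 qr u \<sigma> e in auto)
  moreover have "{..<3::nat} = {0, 1, 2}" by auto
  ultimately show ?thesis by (simp add: \<alpha>(2) Un_ac)
qed

section \<open>The tied blades\<close>

lemma path_image_horizontal_linepath:
  "a \<le> b \<Longrightarrow> path_image (linepath (Complex a y) (Complex b y)) = {z. Im z = y \<and> a \<le> Re z \<and> Re z \<le> b}"
  "a \<le> b \<Longrightarrow> path_image (linepath (Complex b y) (Complex a y)) = {z. Im z = y \<and> a \<le> Re z \<and> Re z \<le> b}"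
  by (auto simp: closed_segment_same_Im closed_segment_eq_real_ivl)

lemma path_image_half_plane:
  assumes "g ` {0<..<1} \<subseteq> S" "z \<in> path_image g"
  shows "z = pathstart g \<or> z = pathfinish g \<or> z \<in> S"
proof -
  obtain t where t: "t \<in> {0..1}" "z = g t" using assms by (auto simp: path_image_def)
  then have "t = 0 \<or> t = 1 \<or> t \<in> {0<..<1}" by auto
  then have "t = 0 \<or> t = 1 \<or> g t \<in> S" using assms(1) by blast
  then show ?thesis using t by (auto simp: pathstart_def pathfinish_def)
qed

text \<open>The ties lie in opposite half-planes and the horizontal pieces at three different
  heights, so the pieces meet only in their common ends. The half blades at both ends supply the
  straight pieces needed at the extrema.\<close>

lemma arc_through_blades:
  fixes l r ya yb yc :: real and R L :: "real \<Rightarrow> complex"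
  assumes lr: "l < r" and y: "ya \<noteq> yb" "yb \<noteq> yc" "ya \<noteq> yc"
    and R: "arc R" "pathstart R = Complex r ya" "pathfinish R = Complex r yb"
      "R ` {0<..<1} \<subseteq> {z. r < Re z}"
    and L: "arc L" "pathstart L = Complex l yb" "pathfinish L = Complex l yc"
      "L ` {0<..<1} \<subseteq> {z. Re z < l}"
  defines "m \<equiv> (l + r) / 2"
  defines "g \<equiv> linepath (Complex m ya) (Complex r ya) +++ (R +++
    (linepath (Complex r yb) (Complex l yb) +++ (L +++ linepath (Complex l yc) (Complex m yc))))"
  shows "arc g" and "pathstart g = Complex m ya" and "pathfinish g = Complex m yc"
    and "path_image g = {z. Im z = ya \<and> m \<le> Re z \<and> Re z \<le> r} \<union> path_image R \<union>
      {z. Im z = yb \<and> l \<le> Re z \<and> Re z \<le> r} \<union> path_image L \<union>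
      {z. Im z = yc \<and> l \<le> Re z \<and> Re z \<le> m}"
    and "\<And>s. s \<in> {0..1} \<Longrightarrow> g (1/2 + s/4) = R s"
    and "\<exists>e>0. \<exists>c>0. \<exists>c'>0. \<forall>t\<in>{0..e}. g t = pathstart g + of_real (c * t) * 1 \<and>
      g (1 - t) = pathfinish g - of_real (c' * t) * 1"
proof -
  have m: "l < m" "m < r" using lr by (auto simp: m_def)
  note pi = path_image_horizontal_linepath[OF less_imp_le, OF m(1)]
    path_image_horizontal_linepath[OF less_imp_le, OF m(2)]
    path_image_horizontal_linepath[OF less_imp_le, OF lr]
  have Rim: "z = Complex r ya \<or> z = Complex r yb \<or> r < Re z" if "z \<in> path_image R" for z
    using path_image_half_plane[OF R(4) that] R by auto
  have Lim: "z = Complex l yb \<or> z = Complex l yc \<or> Re z < l" if "z \<in> path_image L" for z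
    using path_image_half_plane[OF L(4) that] L by auto
  let ?g4 = "L +++ linepath (Complex l yc) (Complex m yc)"
  let ?g3 = "linepath (Complex r yb) (Complex l yb) +++ ?g4"
  let ?g2 = "R +++ ?g3"
  have p4: "path_image ?g4 = path_image L \<union> {z. Im z = yc \<and> l \<le> Re z \<and> Re z \<le> m}"
    using L by (simp add: path_image_join pi del: path_image_linepath)
  have p3: "path_image ?g3 = {z. Im z = yb \<and> l \<le> Re z \<and> Re z \<le> r} \<union> path_image ?g4"
    using L by (simp add: path_image_join pi del: path_image_linepath)
  have p2: "path_image ?g2 = path_image R \<union> path_image ?g3"
    using R by (simp add: path_image_join)
  have p1: "path_image g = {z. Im z = ya \<and> m \<le> Re z \<and> Re z \<le> r} \<union> path_image ?g2"
    unfolding g_def using R by (simp add: path_image_join pi del: path_image_linepath)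
  show "path_image g = {z. Im z = ya \<and> m \<le> Re z \<and> Re z \<le> r} \<union> path_image R \<union>
      {z. Im z = yb \<and> l \<le> Re z \<and> Re z \<le> r} \<union> path_image L \<union>
      {z. Im z = yc \<and> l \<le> Re z \<and> Re z \<le> m}"
    unfolding p1 p2 p3 p4 by (simp only: Un_assoc)
  have a4: "arc ?g4"
  proof (rule arc_join)
    show "path_image L \<inter> path_image (linepath (Complex l yc) (Complex m yc))
        \<subseteq> {pathstart (linepath (Complex l yc) (Complex m yc))}"
      using Lim y by (fastforce simp: pi complex_eq_iff simp del: path_image_linepath)
  qed (use L m in auto)
  have a3: "arc ?g3"
  proof (rule arc_join)
    show "path_image (linepath (Complex r yb) (Complex l yb)) \<inter> path_image ?g4 \<subseteq> {pathstart ?g4}"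
      unfolding p4 using Lim y L
      by (fastforce simp: pi complex_eq_iff simp del: path_image_linepath)
  qed (use L a4 lr in auto)
  have a2: "arc ?g2"
  proof (rule arc_join)
    show "path_image R \<inter> path_image ?g3 \<subseteq> {pathstart ?g3}"
      unfolding p3 p4 using Lim Rim y lr m by (fastforce simp: complex_eq_iff)
  qed (use R a3 in auto)
  show "arc g"
    unfolding g_def
  proof (rule arc_join)
    show "path_image (linepath (Complex m ya) (Complex r ya)) \<inter> path_image ?g2 \<subseteq> {pathstart ?g2}"
      unfolding p2 p3 p4 using Lim Rim y R lr m
      by (fastforce simp: pi complex_eq_iff simp del: path_image_linepath)
  qed (use R a2 m in auto)
  show "pathstart g = Complex m ya" "pathfinish g = Complex m yc"
    by (simp_all add: g_def)
  \<comment> \<open>In the nested join \<open>R\<close> occupies the parameters from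
    \<open>1/2\<close> to \<open>3/4\<close>.\<close>
  show "g (1/2 + s/4) = R s" if "s \<in> {0..1}" for s
    using that R by (cases "s = 0") (auto simp: g_def joinpaths_def pathstart_def linepath_def)
  \<comment> \<open>Each half blade has length \<open>(r - l) / 2\<close>; the first takes parameter
    length \<open>1/2\<close> and the last \<open>1/16\<close>, whence the speeds
    \<open>r - l\<close> and \<open>8 * (r - l)\<close>.\<close>
  have "g t = Complex m ya + of_real ((r - l) * t)" if "t \<in> {0..1/16}" for t
    using that by (simp add: g_def joinpaths_def linepath_def complex_eq_iff m_def algebra_simps)
  moreover have "g (1 - t) = Complex m yc - of_real (8 * (r - l) * t)" if "t \<in> {0..1/32}" for t
    using that by (simp add: g_def joinpaths_def linepath_def complex_eq_iff m_def algebra_simps)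
  ultimately show "\<exists>e>0. \<exists>c>0. \<exists>c'>0. \<forall>t\<in>{0..e}. g t = pathstart g + of_real (c * t) * 1 \<and>
      g (1 - t) = pathfinish g - of_real (c' * t) * 1"
    using lr \<open>pathstart g = Complex m ya\<close> \<open>pathfinish g = Complex m yc\<close>
    by (intro exI[of _ "1/32"] exI[of _ "r - l"] exI[of _ "8 * (r - l)"] conjI ballI) auto
qed

text \<open>Following the closed curve, blade \<open>a k\<close> is run from left to right, then come the right tie
  \<open>R k\<close>, blade \<open>b k\<close> from right to left and the left tie \<open>L k\<close>.  Cutting the blades
  \<open>a k\<close> at their midpoints leaves three arcs, which only cross at the right ties.\<close>

lemma trivial_knot_three_right_ties:
  fixes l r :: real and a b :: "nat \<Rightarrow> real" and R L :: "nat \<Rightarrow> real \<Rightarrow> complex"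
    and ha hb hR hL :: "nat \<Rightarrow> complex \<Rightarrow> real"
  assumes lr: "l < r"
    and ab: "\<And>k m. k < 3 \<Longrightarrow> m < 3 \<Longrightarrow> a k \<noteq> b m"
    and aa: "\<And>k m. k < 3 \<Longrightarrow> m < 3 \<Longrightarrow> k \<noteq> m \<Longrightarrow> a k \<noteq> a m"
    and bb: "\<And>k m. k < 3 \<Longrightarrow> m < 3 \<Longrightarrow> k \<noteq> m \<Longrightarrow> b k \<noteq> b m"
    and R: "\<And>k. k < 3 \<Longrightarrow> arc (R k) \<and> pathstart (R k) = Complex r (a k) \<and>
      pathfinish (R k) = Complex r (b k) \<and> R k ` {0<..<1} \<subseteq> {z. r < Re z}"
    and L: "\<And>k. k < 3 \<Longrightarrow> arc (L k) \<and> pathstart (L k) = Complex l (b k) \<and>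
      pathfinish (L k) = Complex l (a (Suc k mod 3)) \<and> L k ` {0<..<1} \<subseteq> {z. Re z < l}"
    and L_disjoint: "\<And>k m. k < 3 \<Longrightarrow> m < 3 \<Longrightarrow> k \<noteq> m \<Longrightarrow> path_image (L k) \<inter> path_image (L m) = {}"
    and R_inter: "\<And>k. k < 3 \<Longrightarrow> path_image (R k) \<inter> path_image (R (Suc k mod 3)) = {x k}"
    and order: "\<And>k. k < 3 \<Longrightarrow> \<exists>s t. 0 \<le> s \<and> s < t \<and> t \<le> 1 \<and>
      R k s = x ((k + 2) mod 3) \<and> R k t = x k"
    and ha: "\<And>k. k < 3 \<Longrightarrow> continuous_on {z. Im z = a k \<and> l \<le> Re z \<and> Re z \<le> r} (ha k)"
    and hb: "\<And>k. k < 3 \<Longrightarrow> continuous_on {z. Im z = b k \<and> l \<le> Re z \<and> Re z \<le> r} (hb k)"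
    and hR: "\<And>k. k < 3 \<Longrightarrow> continuous_on (path_image (R k)) (hR k)"
    and hL: "\<And>k. k < 3 \<Longrightarrow> continuous_on (path_image (L k)) (hL k)"
    and joints: "\<And>k. k < 3 \<Longrightarrow> ha k (Complex r (a k)) = hR k (Complex r (a k)) \<and>
      hR k (Complex r (b k)) = hb k (Complex r (b k)) \<and>
      hb k (Complex l (b k)) = hL k (Complex l (b k)) \<and>
      hL k (Complex l (a (Suc k mod 3))) = ha (Suc k mod 3) (Complex l (a (Suc k mod 3)))"
    and crossing: "\<And>k. k < 3 \<Longrightarrow> hR k (x k) \<noteq> hR (Suc k mod 3) (x k)"
  shows "trivial_knot (\<Union>k<3.
    (\<lambda>z. (z, ha k z)) ` {z. Im z = a k \<and> l \<le> Re z \<and> Re z \<le> r} \<union>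
    (\<lambda>z. (z, hR k z)) ` path_image (R k) \<union>
    (\<lambda>z. (z, hb k z)) ` {z. Im z = b k \<and> l \<le> Re z \<and> Re z \<le> r} \<union>
    (\<lambda>z. (z, hL k z)) ` path_image (L k))"
proof -
  define N :: "nat \<Rightarrow> nat" where "N k = Suc k mod 3" for k
  have N: "N k < 3" "N k \<noteq> k" "N (N k) \<noteq> k" if "k < 3" for k
    using that unfolding less_3_iff N_def by (elim disjE; simp; fail)+
  define m where "m = (l + r) / 2"
  have m: "l < m" "m < r" using lr by (auto simp: m_def)
  define g where "g = (\<lambda>k. linepath (Complex m (a k)) (Complex r (a k)) +++ (R k +++
    (linepath (Complex r (b k)) (Complex l (b k)) +++
      (L k +++ linepath (Complex l (a (N k))) (Complex m (a (N k)))))))"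
  define AR where "AR = (\<lambda>k. {z. Im z = a k \<and> m \<le> Re z \<and> Re z \<le> r})"
  define AL where "AL = (\<lambda>k. {z. Im z = a k \<and> l \<le> Re z \<and> Re z \<le> m})"
  define B where "B = (\<lambda>k. {z. Im z = b k \<and> l \<le> Re z \<and> Re z \<le> r})"
  have g: "arc (g k)" "pathstart (g k) = Complex m (a k)" "pathfinish (g k) = Complex m (a (N k))"
      "path_image (g k) = AR k \<union> path_image (R k) \<union> B k \<union> path_image (L k) \<union> AL (N k)"
      "\<And>s. s \<in> {0..1} \<Longrightarrow> g k (1/2 + s/4) = R k s"
      "\<exists>e>0. \<exists>c>0. \<exists>c'>0. \<forall>t\<in>{0..e}. g k t = pathstart (g k) + of_real (c * t) * 1 \<and>
        g k (1 - t) = pathfinish (g k) - of_real (c' * t) * 1" if "k < 3" for k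
    using arc_through_blades[of l r "a k" "b k" "a (N k)" "R k" "L k"]
      lr ab[of k k] ab[of "N k" k] aa[of k "N k"] R[of k] L[of k] N[of k] that
    by (simp_all add: g_def m_def AR_def AL_def B_def N_def)
  have Rim: "z = Complex r (a k) \<or> z = Complex r (b k) \<or> r < Re z" if "z \<in> path_image (R k)" "k < 3" for z k
    using path_image_half_plane[OF _ that(1), of "{z. r < Re z}"] R that by auto
  have Lim: "z = Complex l (b k) \<or> z = Complex l (a (N k)) \<or> Re z < l" if "z \<in> path_image (L k)" "k < 3" for z k
    using path_image_half_plane[OF _ that(1), of "{z. Re z < l}"] L that by (auto simp: N_def)
  \<comment> \<open>Points are sorted by their position left of, right of, or inside the closed
    strip of the blades; the ends of the ties count as strip points.\<close>
  have mem: "z \<in> path_image (g k) \<longleftrightarrow> Re z < l \<and> z \<in> path_image (L k) \<or> r < Re z \<and> z \<in> path_image (R k) \<or>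
      l \<le> Re z \<and> Re z \<le> r \<and> (Im z = a k \<and> m \<le> Re z \<or> Im z = b k \<or> Im z = a (N k) \<and> Re z \<le> m)"
    if "k < 3" for z k
    unfolding g(4)[OF that] AR_def AL_def B_def
    using Rim[OF _ that, of z] Lim[OF _ that, of z] m by auto
  have xR: "x k \<in> path_image (R k)" "x k \<in> path_image (R (N k))" if "k < 3" for k
    using R_inter[OF that] by (auto simp: N_def)
  have xr: "r < Re (x k)" if "k < 3" for k
    using Rim[of "x k" k] Rim[of "x k" "N k"] xR[OF that] that N[OF that] ab[of k "N k"] ab[of "N k" k]
      aa[of k "N k"] bb[of k "N k"] by auto
  \<comment> \<open>The height on arc \<open>k\<close> is chosen by the position in the plane alone.
    At the blade ends the blade takes precedence, and \<open>joints\<close> makes this agree with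
    the ties.\<close>
  define h where "h = (\<lambda>k z. if Re z < l then hL k z else if r < Re z then hR k z
    else if Im z = a k then ha k z else if Im z = b k then hb k z else ha (N k) z)"
  have h: "z \<in> AR k \<Longrightarrow> h k z = ha k z" "z \<in> path_image (R k) \<Longrightarrow> h k z = hR k z"
      "z \<in> B k \<Longrightarrow> h k z = hb k z" "z \<in> path_image (L k) \<Longrightarrow> h k z = hL k z"
      "z \<in> AL (N k) \<Longrightarrow> h k z = ha (N k) z" if k: "k < 3" for k z
  proof -
    have ne: "b k \<noteq> a k" "a (N k) \<noteq> a k" "a (N k) \<noteq> b k"
      using k N[OF k] ab[of k k] ab[of "N k" k] aa[of k "N k"] by auto
    have "Suc k mod 3 = N k" by (simp add: N_def)
    note j = joints[OF k, unfolded this]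
    show "h k z = ha k z" if "z \<in> AR k" using that m by (simp add: h_def AR_def)
    show "h k z = hb k z" if "z \<in> B k" using that ne by (simp add: h_def B_def)
    show "h k z = ha (N k) z" if "z \<in> AL (N k)" using that m ne by (simp add: h_def AL_def)
    show "h k z = hR k z" if "z \<in> path_image (R k)"
      using Rim[OF that k] lr ne(1) j by (elim disjE) (simp_all add: h_def)
    show "h k z = hL k z" if "z \<in> path_image (L k)"
      using Lim[OF that k] lr ne j by (elim disjE) (simp_all add: h_def)
  qed
  obtain s t where st: "\<And>k. k < 3 \<Longrightarrow> 0 \<le> s k \<and> s k < t k \<and> t k \<le> 1 \<and>
      R k (s k) = x ((k + 2) mod 3) \<and> R k (t k) = x k"
    using order by metis
  have "trivial_knot (\<Union>k<3. (\<lambda>z. (z, h k z)) ` path_image (g k))"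
  proof (rule trivial_knot_three_arcs[where v = 1 and x = x and p = "\<lambda>k. 1/2 + s k / 4"
        and p' = "\<lambda>k. 1/2 + t k / 4"])
    fix k :: nat assume k: "k < 3"
    show "arc (g k)" using g(1)[OF k] .
    show "pathfinish (g k) = pathstart (g (Suc k mod 3))"
      using g(2)[of "N k"] g(3)[OF k] N[OF k] by (simp add: N_def)
    show "path_image (g k) \<inter> path_image (g (Suc k mod 3)) = {pathfinish (g k), x k}"
    proof (intro equalityI subsetI)
      fix z assume z: "z \<in> path_image (g k) \<inter> path_image (g (Suc k mod 3))"
      then have z1: "z \<in> path_image (g k)" and z2: "z \<in> path_image (g (N k))" by (auto simp: N_def)
      consider "Re z < l" | "r < Re z" | "l \<le> Re z" "Re z \<le> r" by linarith
      then show "z \<in> {pathfinish (g k), x k}"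
      proof cases
        case 1
        then have "z \<in> path_image (L k) \<inter> path_image (L (N k))"
          using mem[OF k, of z] mem[OF N(1)[OF k], of z] z1 z2 lr by auto
        then show ?thesis using L_disjoint[of k "N k"] k N[OF k] by auto
      next
        case 2
        then have "z \<in> path_image (R k) \<inter> path_image (R (N k))"
          using mem[OF k, of z] mem[OF N(1)[OF k], of z] z1 z2 lr by auto
        then show ?thesis using R_inter[OF k] by (simp add: N_def)
      next
        case 3
        note N' = N[OF k] N[OF N(1)[OF k]]
        have "a k \<noteq> b (N k)" "a (N k) \<noteq> b k" "a (N k) \<noteq> b (N k)" "a (N (N k)) \<noteq> b k"
            "a k \<noteq> a (N k)" "a k \<noteq> a (N (N k))" "a (N k) \<noteq> a (N (N k))" "b k \<noteq> b (N k)"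
          by (simp_all add: ab aa bb k N' N'(2,3,5)[symmetric])
        moreover have "Im z = a k \<and> m \<le> Re z \<or> Im z = b k \<or> Im z = a (N k) \<and> Re z \<le> m"
          using 3 mem[OF k, of z] z1 by linarith
        moreover have "Im z = a (N k) \<and> m \<le> Re z \<or> Im z = b (N k) \<or> Im z = a (N (N k)) \<and> Re z \<le> m"
          using 3 mem[OF N(1)[OF k], of z] z2 by linarith
        \<comment> \<open>Only blade \<open>a (N k)\<close> occurs in both arcs, once with its left
          and once with its right half, which leaves its midpoint.\<close>
        ultimately have "Im z = a (N k) \<and> Re z = m" by (elim disjE) auto
        then show ?thesis using g(3)[OF k] by (simp add: complex_eq_iff)
      qed
    next
      fix z assume "z \<in> {pathfinish (g k), x k}"
      moreover have "x k \<in> path_image (g k)" "x k \<in> path_image (g (N k))"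
        using xR[OF k] xr[OF k] by (simp_all add: mem k N(1)[OF k])
      moreover have "pathfinish (g k) \<in> path_image (g k)" "pathfinish (g k) \<in> path_image (g (N k))"
        using g(3)[OF k] m by (simp_all add: mem k N(1)[OF k])
      ultimately show "z \<in> path_image (g k) \<inter> path_image (g (Suc k mod 3))"
        unfolding N_def by blast
    qed
    show "\<exists>e>0. \<exists>c>0. \<exists>c'>0. \<forall>t\<in>{0..e}. g k t = pathstart (g k) + of_real (c * t) * 1 \<and>
        g k (1 - t) = pathfinish (g k) - of_real (c' * t) * 1"
      using g(6)[OF k] .
    show "0 < 1/2 + s k / 4 \<and> 1/2 + s k / 4 < 1/2 + t k / 4 \<and> 1/2 + t k / 4 < 1"
      using st[OF k] by auto
    show "g k (1/2 + s k / 4) = x ((k + 2) mod 3) \<and> g k (1/2 + t k / 4) = x k"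
      using st[OF k] g(5)[OF k, of "s k"] g(5)[OF k, of "t k"] by simp
    show "continuous_on (path_image (g k)) (h k)"
    proof -
      have "continuous_on (AR k) (h k)"
        by (rule continuous_on_eq[OF continuous_on_subset[OF ha[OF k]]]) (use m h[OF k] in \<open>auto simp: AR_def\<close>)
      moreover have "continuous_on (path_image (R k)) (h k)"
        by (rule continuous_on_eq[OF hR[OF k]]) (use h[OF k] in auto)
      moreover have "continuous_on (B k) (h k)"
        by (rule continuous_on_eq[OF continuous_on_subset[OF hb[OF k]]]) (use m h[OF k] in \<open>auto simp: B_def\<close>)
      moreover have "continuous_on (path_image (L k)) (h k)"
        by (rule continuous_on_eq[OF hL[OF k]]) (use h[OF k] in auto)
      moreover have "continuous_on (AL (N k)) (h k)"
        by (rule continuous_on_eq[OF continuous_on_subset[OF ha[OF N(1)[OF k]]]])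
           (use m h[OF k] in \<open>auto simp: AL_def\<close>)
      moreover have "closed (AR j)" "closed (AL j)" "closed (B j)" for j
        unfolding AR_def AL_def B_def
        by (intro closed_Collect_conj closed_Collect_eq closed_Collect_le continuous_intros)+
      ultimately show ?thesis
        unfolding g(4)[OF k] using R[OF k] L[OF k]
        by (intro continuous_on_closed_Un closed_Un) (auto simp: closed_arc_image)
    qed
    show "h k (pathfinish (g k)) = h (Suc k mod 3) (pathfinish (g k))"
      using h(5)[OF k, of "pathfinish (g k)"] h(1)[OF N(1)[OF k], of "pathfinish (g k)"] g(3)[OF k] m
      by (simp add: AR_def AL_def flip: N_def)
    show "h k (x k) \<noteq> h (Suc k mod 3) (x k)"
      using h(2)[OF k] h(2)[OF N(1)[OF k]] xR[OF k] crossing[OF k] by (simp add: N_def)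
  qed simp
  also have "(\<Union>k<3. (\<lambda>z. (z, h k z)) ` path_image (g k)) = (\<Union>k<3. (\<lambda>z. (z, ha k z)) ` AR k \<union>
      (\<lambda>z. (z, hR k z)) ` path_image (R k) \<union> (\<lambda>z. (z, hb k z)) ` B k \<union>
      (\<lambda>z. (z, hL k z)) ` path_image (L k) \<union> (\<lambda>z. (z, ha (N k) z)) ` AL (N k))"
    by (intro SUP_cong refl, unfold lessThan_iff, subst g(4), assumption, unfold image_Un)
       (intro arg_cong2[where f="(\<union>)"] image_cong refl; simp add: h)
  \<comment> \<open>Each blade is reassembled from its halves, the left half coming from the
    preceding arc.\<close>
  also have "\<dots> = (\<Union>k<3. (\<lambda>z. (z, ha k z)) ` (AR k \<union> AL k) \<union>
      (\<lambda>z. (z, hR k z)) ` path_image (R k) \<union> (\<lambda>z. (z, hb k z)) ` B k \<union>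
      (\<lambda>z. (z, hL k z)) ` path_image (L k))"
  proof -
    have "{..<3::nat} = {0, 1, 2}" by auto
    moreover have "N 0 = 1" "N 1 = 2" "N 2 = 0" by (auto simp: N_def)
    ultimately show ?thesis by (simp add: image_Un) blast
  qed
  finally have *: "trivial_knot \<dots>" .
  have "AR k \<union> AL k = {z. Im z = a k \<and> l \<le> Re z \<and> Re z \<le> r}" for k
    using m by (auto simp: AR_def AL_def)
  with * show ?thesis by (simp add: B_def)
qed

section \<open>From the diagram to the closed curve\<close>

definition tie_of :: "nat \<Rightarrow> nat \<Rightarrow> tie" where
  "tie_of i j = (min i j, max i j)"

text \<open>Ties are stored from the smaller blade, while the closed curve may run them from the
  larger one.\<close>

definition oriented_tie :: "(tie \<Rightarrow> real \<Rightarrow> complex) \<Rightarrow> nat \<Rightarrow> nat \<Rightarrow> real \<Rightarrow> complex" where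
  "oriented_tie G i j = (if i < j then G (i, j) else reversepath (G (j, i)))"

lemma path_image_oriented_tie [simp]:
  "path_image (oriented_tie G i j) = path_image (G (tie_of i j))"
  by (auto simp: oriented_tie_def tie_of_def)

lemma end_drawing_oriented_tie:
  assumes X: "end_drawing X p S G" and ij: "tie_of i j \<in> ties X" "i \<noteq> j"
  shows "arc (oriented_tie G i j) \<and> pathstart (oriented_tie G i j) = p i \<and>
    pathfinish (oriented_tie G i j) = p j \<and> oriented_tie G i j ` {0<..<1} \<subseteq> S"
proof -
  have *: "arc (G (i, j)) \<and> pathstart (G (i, j)) = p i \<and> pathfinish (G (i, j)) = p j \<and>
      G (i, j) ` {0<..<1} \<subseteq> S" if "(i, j) \<in> ties X" for i j
  proof -
    have "\<forall>(i, j)\<in>ties X. arc (G (i, j)) \<and> pathstart (G (i, j)) = p i \<and> pathfinish (G (i, j)) = p j \<and>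
        G (i, j) ` {0<..<1} \<subseteq> S"
      using X unfolding end_drawing_def by (elim conjE)
    from bspec[OF this that] show ?thesis by simp
  qed
  show ?thesis
  proof (cases "i < j")
    case True
    then show ?thesis using *[of i j] ij by (simp add: oriented_tie_def tie_of_def)
  next
    case False
    then have "(j, i) \<in> ties X" using ij by (simp add: tie_of_def)
    note ji = *[OF this]
    moreover have "reversepath (G (j, i)) ` {0<..<1} \<subseteq> S"
      using ji by (auto simp: reversepath_def image_subset_iff)
    ultimately show ?thesis using False by (simp add: oriented_tie_def arc_reversepath)
  qed
qed

text \<open>The closed curve runs blade \<open>i k\<close> to the right and blade \<open>j k\<close>
  to the left, in the cyclic order \<open>i 0, j 0, i 1, j 1, i 2, j 2\<close>. Hypothesis
  \<open>order\<close> encodes that each right tie, in the direction of the curve, meets its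
  predecessor before its successor; for a tie run from its larger blade the stored order is
  reversed. This reduces both theorems to finite checks.\<close>

lemma trivial_knot_of_diagram:
  fixes i j :: "nat \<Rightarrow> nat"
  assumes proj: "six_blade_projection X Y D" and diag: "has_diagram X Y D u K"
    and blades: "i ` {..<3} \<union> j ` {..<3} = {1..6}"
    and ij: "\<And>k m. k < 3 \<Longrightarrow> m < 3 \<Longrightarrow> i k \<noteq> j m"
    and ii: "\<And>k m. k < 3 \<Longrightarrow> m < 3 \<Longrightarrow> k \<noteq> m \<Longrightarrow> i k \<noteq> i m"
    and jj: "\<And>k m. k < 3 \<Longrightarrow> m < 3 \<Longrightarrow> k \<noteq> m \<Longrightarrow> j k \<noteq> j m"
    and Y: "ties Y = (\<lambda>k. tie_of (i k) (j k)) ` {..<3}"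
    and X: "ties X = (\<lambda>k. tie_of (j k) (i (Suc k mod 3))) ` {..<3}"
    and Y_cross: "\<And>k. k < 3 \<Longrightarrow>
      interleave (tie_of (i k) (j k)) (tie_of (i (Suc k mod 3)) (j (Suc k mod 3)))"
    and X_plane: "\<And>e f. e \<in> ties X \<Longrightarrow> f \<in> ties X \<Longrightarrow> \<not> interleave e f"
    and X_distinct: "\<And>k m. k < 3 \<Longrightarrow> m < 3 \<Longrightarrow> k \<noteq> m \<Longrightarrow>
      tie_of (j k) (i (Suc k mod 3)) \<noteq> tie_of (j m) (i (Suc m mod 3))"
    and order: "\<And>k. k < 3 \<Longrightarrow>
      (let e = tie_of (i k) (j k); f = tie_of (i ((k + 2) mod 3)) (j ((k + 2) mod 3));
           f' = tie_of (i (Suc k mod 3)) (j (Suc k mod 3))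
       in if i k < j k then (e, f, f') \<in> crossing_order Y else (e, f', f) \<in> crossing_order Y)"
  shows "trivial_knot K"
proof -
  define N :: "nat \<Rightarrow> nat" where "N k = Suc k mod 3" for k
  define P :: "nat \<Rightarrow> nat" where "P k = (k + 2) mod 3" for k
  have N: "N k < 3" "N k \<noteq> k" "P k < 3" "N (P k) = k" if "k < 3" for k
    using that unfolding less_3_iff N_def P_def by (elim disjE; simp; fail)+
  obtain l r y where lr: "l < r" and y: "strict_antimono_on {1..6} y"
    and blade: "\<And>i. i \<in> {1..6} \<Longrightarrow> D (Blade i) = linepath (Complex l (y i)) (Complex r (y i))"
    and left: "end_drawing X (\<lambda>i. Complex l (y i)) {z. Re z < l} (D \<circ> LTie)"
    and right: "end_drawing Y (\<lambda>i. Complex r (y i)) {z. r < Re z} (D \<circ> RTie)"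
    using proj unfolding six_blade_projection_def by blast
  obtain h where h: "\<And>s. s \<in> strands X Y \<Longrightarrow> continuous_on (path_image (D s)) (h s)"
    and meet: "\<And>s t z. s \<in> strands X Y \<Longrightarrow> t \<in> strands X Y \<Longrightarrow> z \<in> path_image (D s) \<Longrightarrow>
      z \<in> path_image (D t) \<Longrightarrow>
      (if {s, t} \<in> crossings X Y then (if u {s, t} = s then h t z < h s z else h s z < h t z)
       else h s z = h t z)"
    and K: "K = (\<Union>s\<in>strands X Y. (\<lambda>z. (z, h s z)) ` path_image (D s))"
    using diag unfolding has_diagram_def by blast
  define R where "R k = oriented_tie (D \<circ> RTie) (i k) (j k)" for k
  define L where "L k = oriented_tie (D \<circ> LTie) (j k) (i (N k))" for k
  define sR where "sR k = RTie (tie_of (i k) (j k))" for k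
  define sL where "sL k = LTie (tie_of (j k) (i (N k)))" for k
  have pR: "path_image (R k) = path_image (D (sR k))" and pL: "path_image (L k) = path_image (D (sL k))" for k
    by (simp_all add: R_def L_def sR_def sL_def)
  have in6: "i k \<in> {1..6}" "j k \<in> {1..6}" if "k < 3" for k
    using blades that by blast+
  have strand: "Blade (i k) \<in> strands X Y" "Blade (j k) \<in> strands X Y" "sR k \<in> strands X Y"
      "sL k \<in> strands X Y" if "k < 3" for k
    using that in6[OF that] X Y by (auto simp: strands_def sR_def sL_def N_def)
  have pB: "path_image (D (Blade n)) = {z. Im z = y n \<and> l \<le> Re z \<and> Re z \<le> r}" if "n \<in> {1..6}" for n
    unfolding blade[OF that] using path_image_horizontal_linepath lr by simp
  have yne: "y n \<noteq> y n'" if "n \<in> {1..6}" "n' \<in> {1..6}" "n \<noteq> n'" for n n'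
    using monotone_onD[OF y that(1,2)] monotone_onD[OF y that(2,1)] that(3) by (metis less_irrefl nat_neq_iff)
  have R: "arc (R k) \<and> pathstart (R k) = Complex r (y (i k)) \<and>
      pathfinish (R k) = Complex r (y (j k)) \<and> R k ` {0<..<1} \<subseteq> {z. r < Re z}" if "k < 3" for k
    unfolding R_def using end_drawing_oriented_tie[OF right, of "i k" "j k"] Y ij[OF that that] that by auto
  have L: "arc (L k) \<and> pathstart (L k) = Complex l (y (j k)) \<and>
      pathfinish (L k) = Complex l (y (i (N k))) \<and> L k ` {0<..<1} \<subseteq> {z. Re z < l}" if "k < 3" for k
    unfolding L_def
    using end_drawing_oriented_tie[OF left, of "j k" "i (N k)"] X ij[OF N(1)[OF that] that] that
    by (auto simp: N_def)
  have inter: "if interleave e f then \<exists>!z. z \<in> path_image (G e) \<inter> path_image (G f)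
      else path_image (G e) \<inter> path_image (G f) = {}"
    if "end_drawing Z p S G" "e \<in> ties Z" "f \<in> ties Z" "e \<noteq> f" for Z p S G e f
    using that unfolding end_drawing_def by blast
  have tieY: "tie_of (i k) (j k) \<in> ties Y" if "k < 3" for k
    using that Y by auto
  have tie_ne: "tie_of (i k) (j k) \<noteq> tie_of (i (N k)) (j (N k))" if "k < 3" for k
  proof -
    have "\<not> interleave e e" for e by (cases e) simp
    then show ?thesis using Y_cross[OF that] unfolding N_def by metis
  qed
  have "\<exists>z. path_image (R k) \<inter> path_image (R (N k)) = {z}" if "k < 3" for k
    using inter[OF right tieY[OF that] tieY[OF N(1)[OF that]] tie_ne[OF that]] Y_cross[OF that]
    by (simp add: R_def N_def) blast
  then obtain x where x: "\<And>k. k < 3 \<Longrightarrow> path_image (R k) \<inter> path_image (R (N k)) = {x k}"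
    by metis
  have cross: "{sR k, sR (N k)} \<in> crossings X Y" if "k < 3" for k
    using tieY[OF that] tieY[OF N(1)[OF that]] Y_cross[OF that]
    unfolding crossings_def sR_def N_def by blast
  have no_cross: "{Blade n, s} \<notin> crossings X Y" "{s, Blade n} \<notin> crossings X Y" for n s
    by (auto simp: crossings_def doubleton_eq_iff)
  \<comment> \<open>A crossing consists of two ties, so a common point with a blade always falls
    under the clause of equal heights.\<close>
  have joint: "h (Blade n) z = h s z"
    if "s \<in> strands X Y" "n \<in> {1..6}" "z \<in> path_image (D (Blade n))" "z \<in> path_image (D s)" for n s z
    using meet[of "Blade n" s z] that no_cross by (auto simp: strands_def)
  have "trivial_knot (\<Union>k<3.
    (\<lambda>z. (z, h (Blade (i k)) z)) ` {z. Im z = y (i k) \<and> l \<le> Re z \<and> Re z \<le> r} \<union>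
    (\<lambda>z. (z, h (sR k) z)) ` path_image (R k) \<union>
    (\<lambda>z. (z, h (Blade (j k)) z)) ` {z. Im z = y (j k) \<and> l \<le> Re z \<and> Re z \<le> r} \<union>
    (\<lambda>z. (z, h (sL k) z)) ` path_image (L k))"
  proof (rule trivial_knot_three_right_ties[OF lr, where x = x])
    fix k :: nat assume k: "k < 3"
    note Nk = N[OF k]
    show "arc (R k) \<and> pathstart (R k) = Complex r (y (i k)) \<and>
      pathfinish (R k) = Complex r (y (j k)) \<and> R k ` {0<..<1} \<subseteq> {z. r < Re z}" using R[OF k] .
    show "arc (L k) \<and> pathstart (L k) = Complex l (y (j k)) \<and>
      pathfinish (L k) = Complex l (y (i (Suc k mod 3))) \<and> L k ` {0<..<1} \<subseteq> {z. Re z < l}"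
      using L[OF k] by (simp add: N_def)
    show "path_image (R k) \<inter> path_image (R (Suc k mod 3)) = {x k}" using x[OF k] by (simp add: N_def)
    show "\<exists>s t. 0 \<le> s \<and> s < t \<and> t \<le> 1 \<and> R k s = x ((k + 2) mod 3) \<and> R k t = x k"
    proof -
      have "x k \<in> path_image (R k)" "x k \<in> path_image (R (N k))"
        "x (P k) \<in> path_image (R (P k))" "x (P k) \<in> path_image (R k)"
        using x[OF k] x[OF Nk(3)] Nk(4) by auto
      then obtain s t where st: "s \<in> {0..1}" "t \<in> {0..1}" "R k s = x (P k)" "R k t = x k"
        and on: "R k s \<in> path_image (D (sR (P k)))" "R k t \<in> path_image (D (sR (N k)))"
        unfolding pR[symmetric] by (auto simp: path_image_def[of "R k"])
      have ord: "s < t" if "(e, f, f') \<in> crossing_order Y" "s \<in> {0..1}" "t \<in> {0..1}"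
          "(D \<circ> RTie) e s \<in> path_image ((D \<circ> RTie) f)" "(D \<circ> RTie) e t \<in> path_image ((D \<circ> RTie) f')"
        for e f f' s t
        using right that unfolding end_drawing_def by blast
      have "s < t"
      proof (cases "i k < j k")
        case True
        then have "(D \<circ> RTie) (tie_of (i k) (j k)) = R k" by (simp add: R_def oriented_tie_def tie_of_def)
        then show ?thesis
          using ord[OF _ st(1,2), of "tie_of (i k) (j k)"] order[OF k] True on
          by (simp add: Let_def sR_def P_def N_def)
      next
        case False
        then have "R k = reversepath ((D \<circ> RTie) (tie_of (i k) (j k)))"
          using ij[OF k k] by (simp add: R_def oriented_tie_def tie_of_def)
        then have "R k a = (D \<circ> RTie) (tie_of (i k) (j k)) (1 - a)" for a
          by (simp add: reversepath_def)
        \<comment> \<open>Running the tie backwards complements the parameters, which turns the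
          reversed triple into the wanted order.\<close>
        then have "1 - t < 1 - s"
          using ord[of "tie_of (i k) (j k)" _ _ "1 - t" "1 - s"] st order[OF k] False on
          by (simp add: Let_def sR_def P_def N_def)
        then show ?thesis by simp
      qed
      then show ?thesis using st by (auto simp: P_def)
    qed
    show "continuous_on {z. Im z = y (i k) \<and> l \<le> Re z \<and> Re z \<le> r} (h (Blade (i k)))"
      "continuous_on {z. Im z = y (j k) \<and> l \<le> Re z \<and> Re z \<le> r} (h (Blade (j k)))"
      using h[OF strand(1)[OF k]] h[OF strand(2)[OF k]] by (simp_all only: pB in6[OF k])
    show "continuous_on (path_image (R k)) (h (sR k))" "continuous_on (path_image (L k)) (h (sL k))"
      using h[OF strand(3)[OF k]] h[OF strand(4)[OF k]] by (simp_all only: pR pL)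
    show "h (Blade (i k)) (Complex r (y (i k))) = h (sR k) (Complex r (y (i k))) \<and>
      h (sR k) (Complex r (y (j k))) = h (Blade (j k)) (Complex r (y (j k))) \<and>
      h (Blade (j k)) (Complex l (y (j k))) = h (sL k) (Complex l (y (j k))) \<and>
      h (sL k) (Complex l (y (i (Suc k mod 3)))) =
        h (Blade (i (Suc k mod 3))) (Complex l (y (i (Suc k mod 3))))"
    proof -
      have "Complex r (y (i k)) \<in> path_image (D (sR k))" "Complex r (y (j k)) \<in> path_image (D (sR k))"
        "Complex l (y (j k)) \<in> path_image (D (sL k))" "Complex l (y (i (N k))) \<in> path_image (D (sL k))"
        using R[OF k] L[OF k] pathstart_in_path_image[of "R k"] pathfinish_in_path_image[of "R k"]
          pathstart_in_path_image[of "L k"] pathfinish_in_path_image[of "L k"]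
        by (simp_all add: pR pL)
      then show ?thesis
        using joint[OF strand(3)[OF k] in6(1)[OF k]] joint[OF strand(3)[OF k] in6(2)[OF k]]
          joint[OF strand(4)[OF k] in6(2)[OF k]] joint[OF strand(4)[OF k] in6(1)[OF Nk(1)]] lr
        by (simp add: pB[OF in6(1)[OF k]] pB[OF in6(2)[OF k]] pB[OF in6(1)[OF Nk(1)]] flip: N_def)
    qed
    \<comment> \<open>Whichever strand \<open>u\<close> makes the upper one, the two heights differ;
      thus all choices at the crossings are treated at once.\<close>
    show "h (sR k) (x k) \<noteq> h (sR (Suc k mod 3)) (x k)"
    proof -
      have "x k \<in> path_image (D (sR k)) \<inter> path_image (D (sR (N k)))"
        using x[OF k] by (simp add: pR)
      then show ?thesis
        using meet[OF strand(3)[OF k] strand(3)[OF Nk(1)], of "x k"] cross[OF k]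
        by (simp flip: N_def split: if_splits)
    qed
    fix m :: nat assume m: "m < 3"
    show "y (i k) \<noteq> y (j m)" using yne in6 ij k m by blast
    assume km: "k \<noteq> m"
    show "y (i k) \<noteq> y (i m)" "y (j k) \<noteq> y (j m)" using yne in6 ii jj k m km by blast+
    have "tie_of (j k) (i (N k)) \<in> ties X" "tie_of (j m) (i (N m)) \<in> ties X"
      using X k m by (auto simp: N_def)
    then show "path_image (L k) \<inter> path_image (L m) = {}"
      using inter[OF left, of "tie_of (j k) (i (N k))" "tie_of (j m) (i (N m))"]
        X_plane X_distinct[OF k m km]
      by (simp add: L_def flip: N_def)
  qed
  also have "(\<Union>k<3.
    (\<lambda>z. (z, h (Blade (i k)) z)) ` {z. Im z = y (i k) \<and> l \<le> Re z \<and> Re z \<le> r} \<union>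
    (\<lambda>z. (z, h (sR k) z)) ` path_image (R k) \<union>
    (\<lambda>z. (z, h (Blade (j k)) z)) ` {z. Im z = y (j k) \<and> l \<le> Re z \<and> Re z \<le> r} \<union>
    (\<lambda>z. (z, h (sL k) z)) ` path_image (L k)) =
    (\<Union>k<3. \<Union>s\<in>{Blade (i k), sR k, Blade (j k), sL k}. (\<lambda>z. (z, h s z)) ` path_image (D s))"
  proof (intro SUP_cong refl)
    fix k :: nat assume "k \<in> {..<3}"
    then have "k < 3" by simp
    note pB[OF in6(1)[OF this]] pB[OF in6(2)[OF this]]
    then show "(\<lambda>z. (z, h (Blade (i k)) z)) ` {z. Im z = y (i k) \<and> l \<le> Re z \<and> Re z \<le> r} \<union>
        (\<lambda>z. (z, h (sR k) z)) ` path_image (R k) \<union>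
        (\<lambda>z. (z, h (Blade (j k)) z)) ` {z. Im z = y (j k) \<and> l \<le> Re z \<and> Re z \<le> r} \<union>
        (\<lambda>z. (z, h (sL k) z)) ` path_image (L k) =
        (\<Union>s\<in>{Blade (i k), sR k, Blade (j k), sL k}. (\<lambda>z. (z, h s z)) ` path_image (D s))"
      by (simp add: pR pL Un_assoc)
  qed
  also have "\<dots> = (\<Union>s\<in>(\<Union>k<3. {Blade (i k), sR k, Blade (j k), sL k}). (\<lambda>z. (z, h s z)) ` path_image (D s))"
    by blast
  also have "(\<Union>k<3. {Blade (i k), sR k, Blade (j k), sL k}) = strands X Y"
    unfolding strands_def blades[symmetric] X Y sR_def sL_def N_def by blast
  finally show ?thesis using K by simp
qed

theorem lemma3:
  shows "(\<forall>D u K. six_blade_projection A1 E1 D \<and> over_under_choice A1 E1 u \<and>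
            has_diagram A1 E1 D u K \<longrightarrow> trivial_knot K) \<and>
         (\<forall>D u K. six_blade_projection A2 E2 D \<and> over_under_choice A2 E2 u \<and>
            has_diagram A2 E2 D u K \<longrightarrow> trivial_knot K)"
proof (intro conjI allI impI; elim conjE)
  have less3: "{..<3::nat} = {0, 1, 2}" by auto
  have six: "{1..6::nat} = {1, 2, 3, 4, 5, 6}" by auto
  fix D u K
  show "trivial_knot K" if "six_blade_projection A1 E1 D" "has_diagram A1 E1 D u K"
  \<comment> \<open>Following the curve from blade 1: right tie 14, left tie 34, right tie 36, left
    tie 56, right tie 25 from 5 to 2, left tie 12.\<close>
  proof (rule trivial_knot_of_diagram[OF that, where i = "(!) [1, 3, 5]" and j = "(!) [4, 6, 2]"])
    show "(!) [1, 3, 5] ` {..<3} \<union> (!) [4, 6, 2] ` {..<3} = {1..6::nat}"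
      unfolding less3 six by auto
    fix k m :: nat assume "k < 3"
    then have k: "k = 0 \<or> k = 1 \<or> k = 2" by auto
    show "interleave (tie_of ([1, 3, 5] ! k) ([4, 6, 2] ! k))
        (tie_of ([1, 3, 5] ! (Suc k mod 3)) ([4, 6, 2] ! (Suc k mod 3)))"
      using k by (elim disjE) (simp_all add: tie_of_def)
    show "let e = tie_of ([1, 3, 5] ! k) ([4, 6, 2] ! k);
          f = tie_of ([1, 3, 5] ! ((k + 2) mod 3)) ([4, 6, 2] ! ((k + 2) mod 3));
          f' = tie_of ([1, 3, 5] ! (Suc k mod 3)) ([4, 6, 2] ! (Suc k mod 3))
      in if [1, 3, 5 :: nat] ! k < [4, 6, 2] ! k then (e, f, f') \<in> crossing_order E1
         else (e, f', f) \<in> crossing_order E1"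
      using k by (elim disjE) (simp_all add: tie_of_def Let_def)
    assume "m < 3"
    then have m: "m = 0 \<or> m = 1 \<or> m = 2" by auto
    show "[1, 3, 5 :: nat] ! k \<noteq> [4, 6, 2] ! m"
      using k m by (elim disjE) simp_all
    assume "k \<noteq> m"
    then show "[1, 3, 5 :: nat] ! k \<noteq> [1, 3, 5] ! m" "[4, 6, 2 :: nat] ! k \<noteq> [4, 6, 2] ! m"
      "tie_of ([4, 6, 2] ! k) ([1, 3, 5] ! (Suc k mod 3)) \<noteq>
        tie_of ([4, 6, 2] ! m) ([1, 3, 5] ! (Suc m mod 3))"
      using k m by (elim disjE; simp add: tie_of_def)+
  qed (auto simp: less3 tie_of_def)
  show "trivial_knot K" if "six_blade_projection A2 E2 D" "has_diagram A2 E2 D u K"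
  \<comment> \<open>Here the curve runs through right tie 14, left tie 45, right tie 25 from 5 to 2,
    left tie 23, right tie 36, left tie 16.\<close>
  proof (rule trivial_knot_of_diagram[OF that, where i = "(!) [1, 5, 3]" and j = "(!) [4, 2, 6]"])
    show "(!) [1, 5, 3] ` {..<3} \<union> (!) [4, 2, 6] ` {..<3} = {1..6::nat}"
      unfolding less3 six by auto
    fix k m :: nat assume "k < 3"
    then have k: "k = 0 \<or> k = 1 \<or> k = 2" by auto
    show "interleave (tie_of ([1, 5, 3] ! k) ([4, 2, 6] ! k))
        (tie_of ([1, 5, 3] ! (Suc k mod 3)) ([4, 2, 6] ! (Suc k mod 3)))"
      using k by (elim disjE) (simp_all add: tie_of_def)
    show "let e = tie_of ([1, 5, 3] ! k) ([4, 2, 6] ! k);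
          f = tie_of ([1, 5, 3] ! ((k + 2) mod 3)) ([4, 2, 6] ! ((k + 2) mod 3));
          f' = tie_of ([1, 5, 3] ! (Suc k mod 3)) ([4, 2, 6] ! (Suc k mod 3))
      in if [1, 5, 3 :: nat] ! k < [4, 2, 6] ! k then (e, f, f') \<in> crossing_order E2
         else (e, f', f) \<in> crossing_order E2"
      using k by (elim disjE) (simp_all add: tie_of_def Let_def)
    assume "m < 3"
    then have m: "m = 0 \<or> m = 1 \<or> m = 2" by auto
    show "[1, 5, 3 :: nat] ! k \<noteq> [4, 2, 6] ! m"
      using k m by (elim disjE) simp_all
    assume "k \<noteq> m"
    then show "[1, 5, 3 :: nat] ! k \<noteq> [1, 5, 3] ! m" "[4, 2, 6 :: nat] ! k \<noteq> [4, 2, 6] ! m"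
      "tie_of ([4, 2, 6] ! k) ([1, 5, 3] ! (Suc k mod 3)) \<noteq>
        tie_of ([4, 2, 6] ! m) ([1, 5, 3] ! (Suc m mod 3))"
      using k m by (elim disjE; simp add: tie_of_def)+
  qed (auto simp: less3 tie_of_def)
qed

end
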